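(* Let $N\ge 2$ be an integer, let $\alpha>-1$ and $\sigma\in(-2\alpha,2)$. Then for any real $Q$ with $$2\le Q\le Q_{cr}(N,\alpha,\sigma):=\frac{2\left(N+\frac{2\alpha+\sigma}{2-\sigma}\right)}{N+\frac{2\alpha+\sigma}{2-\sigma}-2},$$ there exists a positive constant $C=C(Q,N,\alpha,\sigma)$ such that for every $f\in C_0^\infty(\mathcal H_1)$ $$\left(\int_{\mathcal C_1}(1-|\lambda|)^\alpha|f(x',\lambda)|^Q\,dx'\,d\lambda\right)^{\frac2Q}\le C\int_{\mathcal C_1}(1-|\lambda|)^\alpha\left(|\nabla_{x'}f|^2+(1-|\lambda|)^\sigma|\partial_\lambda f|^2\right)dx'\,d\lambda.\qquad( * )$$ In the limit case $\sigma=2$ (with $N\ge2$, $\alpha>-1$): estimate $( * )$ holds with $Q=2$ for all $f\in C_0^\infty(\mathcal H_1)$ with some constant $C$; but for every $Q>2$ it fails on $C_0^\infty(\mathcal C_1)$, i.e. for no finite constant $C$ does $( * )$ with $\sigma=2$ hold for all $f\in C_0^\infty(\mathcal C_1)$.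
   Context: Points of $\mathbb R^N$ are written $(x',\lambda)\in\mathbb R^{N-1}\times\mathbb R$. The infinite and finite cylinders are $\mathcal H_1:=\{(x',\lambda)\in\mathbb R^{N-1}\times\mathbb R:|x'|<1\}$ and $\mathcal C_1:=\{(x',\lambda)\in\mathbb R^{N-1}\times\mathbb R:|x'|<1,\ |\lambda|<1\}$. $C_0^\infty(U)$ denotes the smooth real-valued functions with compact support in the open set $U$ (so functions in $C_0^\infty(\mathcal H_1)$ need not vanish near $\{\lambda=\pm1\}$). $\nabla_{x'}$ is the gradient in the $x'$ variables. The right-hand side may be $+\infty$, in which case the inequality is trivially true. *)

theory Defs
  imports "HOL-Analysis.Analysis"
begin

text \<open>The space \<open>\<real>\<^sup>N = \<real>\<^sup>N\<^sup>-\<^sup>1 \<times> \<real>\<close> is represented by \<open>(real ^ 'n) \<times> real\<close> with \<open>CARD('n) = N - 1\<close>;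
  \<open>lborel\<close> on this product type is \<open>N\<close>-dimensional Lebesgue measure.\<close>

definition inf_cyl :: "((real ^ 'n) \<times> real) set" where
  "inf_cyl = {(x', l). norm x' < 1}"

definition fin_cyl :: "((real ^ 'n) \<times> real) set" where
  "fin_cyl = {(x', l). norm x' < 1 \<and> \<bar>l\<bar> < 1}"

text \<open>\<open>Ck k f\<close>: \<open>f\<close> is \<open>k\<close> times continuously differentiable on the whole space.\<close>

fun Ck :: "nat \<Rightarrow> ('a::euclidean_space \<Rightarrow> real) \<Rightarrow> bool" where
  "Ck 0 f \<longleftrightarrow> continuous_on UNIV f"
| "Ck (Suc k) f \<longleftrightarrow> (\<forall>x. f differentiable (at x)) \<and>
     (\<forall>v. Ck k (\<lambda>x. frechet_derivative f (at x) v))"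

text \<open>A function in \<open>C\<^sub>0\<^sup>\<infinity>(U)\<close>, \<open>U\<close> open, is identified with its extension by zero, which is
  smooth on the whole space and has compact support inside \<open>U\<close>.\<close>

definition Cc_infty :: "'a::euclidean_space set \<Rightarrow> ('a \<Rightarrow> real) set" where
  "Cc_infty U = {f. (\<forall>k. Ck k f) \<and> compact (closure {x. f x \<noteq> 0}) \<and> closure {x. f x \<noteq> 0} \<subseteq> U}"

definition grad_x' :: "((real ^ 'n) \<times> real \<Rightarrow> real) \<Rightarrow> (real ^ 'n) \<times> real \<Rightarrow> real ^ 'n" where
  "grad_x' f p = (\<chi> i. frechet_derivative f (at p) (axis i 1, 0))"

definition d_lambda :: "((real ^ 'n) \<times> real \<Rightarrow> real) \<Rightarrow> (real ^ 'n) \<times> real \<Rightarrow> real" where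
  "d_lambda f p = frechet_derivative f (at p) (0, 1)"

text \<open>Real powers on \<open>[0, \<infinity>]\<close>; only meant for exponents \<open>p > 0\<close>.\<close>

definition ennreal_powr :: "ennreal \<Rightarrow> real \<Rightarrow> ennreal" where
  "ennreal_powr a p = (if a = \<infinity> then \<infinity> else ennreal (enn2real a powr p))"

text \<open>All integrals are taken in \<open>[0, \<infinity>]\<close>. This matters for the energy: the weight exponent
  \<open>\<alpha> + \<sigma>\<close> may be \<open>\<le> -1\<close>, and then the energy can be infinite.\<close>

definition weighted_power_integral ::
  "real \<Rightarrow> real \<Rightarrow> ((real ^ 'n) \<times> real \<Rightarrow> real) \<Rightarrow> ennreal" where
  "weighted_power_integral \<alpha> Q f =
     (\<integral>\<^sup>+p\<in>fin_cyl. ennreal ((1 - \<bar>snd p\<bar>) powr \<alpha> * \<bar>f p\<bar> powr Q) \<partial>lborel)"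

definition weighted_energy ::
  "real \<Rightarrow> real \<Rightarrow> ((real ^ 'n) \<times> real \<Rightarrow> real) \<Rightarrow> ennreal" where
  "weighted_energy \<alpha> \<sigma> f =
     (\<integral>\<^sup>+p\<in>fin_cyl. ennreal ((1 - \<bar>snd p\<bar>) powr \<alpha> *
        ((norm (grad_x' f p))\<^sup>2 + (1 - \<bar>snd p\<bar>) powr \<sigma> * (d_lambda f p)\<^sup>2)) \<partial>lborel)"

definition weighted_sobolev_ineq ::
  "real \<Rightarrow> real \<Rightarrow> real \<Rightarrow> real \<Rightarrow> ((real ^ 'n) \<times> real \<Rightarrow> real) \<Rightarrow> bool" where
  "weighted_sobolev_ineq C Q \<alpha> \<sigma> f \<longleftrightarrow>
     ennreal_powr (weighted_power_integral \<alpha> Q f) (2 / Q) \<le> ennreal C * weighted_energy \<alpha> \<sigma> f"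

definition Q_cr :: "nat \<Rightarrow> real \<Rightarrow> real \<Rightarrow> real" where
  "Q_cr N \<alpha> \<sigma> = 2 * (real N + (2 * \<alpha> + \<sigma>) / (2 - \<sigma>)) / (real N + (2 * \<alpha> + \<sigma>) / (2 - \<sigma>) - 2)"

end

theory Submission
  imports Defs
begin

text \<open>
Write \<open>m = N - 1\<close>, \<open>t = 1 - \<bar>\<lambda>\<bar>\<close> and \<open>\<beta> = \<alpha> + \<sigma>/2\<close>. For \<open>\<sigma> < 2\<close> the substitution
  \<open>s = t\<^sup>1\<^sup>-\<^sup>\<sigma>\<^sup>/\<^sup>2\<close> turns both sides, up to constants, into \<open>\<integral> s\<^sup>A \<bar>f\<bar>\<^sup>Q\<close> and \<open>\<integral> s\<^sup>A \<bar>\<nabla>f\<bar>\<^sup>2\<close> with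
  \<open>A = (2\<alpha> + \<sigma>)/(2 - \<sigma>) > 0\<close>. The weight \<open>s\<^sup>A\<close> acts like \<open>A\<close> additional dimensions, and \<open>Q_cr\<close> is
  the Sobolev exponent \<open>2D/(D - 2)\<close> of the effective dimension \<open>D = N + A\<close>. The proof below keeps the
  variable \<open>\<lambda>\<close> and follows the pattern of Gagliardo and Nirenberg: an inequality for the first
  power of the gradient, applied to a power of \<open>\<bar>f\<bar>\<close>.

  For a nonnegative \<open>C\<^sup>1\<close> function \<open>w\<close> supported in the cylinder let \<open>L\<close> and \<open>P\<close> be the integrals of \<open>w\<close>
  and of \<open>\<Sum>\<^sub>i \<bar>\<partial>\<^sub>i w\<bar>\<close> over the slice at \<open>\<lambda>\<close>, and let
  \<open>K = \<integral> t\<^sup>\<alpha> \<Sum>\<^sub>i \<bar>\<partial>\<^sub>i w\<bar> + t\<^sup>\<beta> \<bar>\<partial>\<^sub>\<lambda> w\<bar>\<close>. On each slice the unweighted inequality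
  \<open>\<integral> w\<^sup>1\<^sup>+\<^sup>1\<^sup>/\<^sup>m \<le> P L\<^sup>1\<^sup>/\<^sup>m\<close> holds (\<open>gagliardo_nirenberg_lborel\<close>). Integrating \<open>\<partial>\<^sub>\<lambda> w\<close> from the middle
  slice outwards gives the pointwise bound \<open>t\<^sup>\<beta> L \<le> C K\<close> and the Hardy inequality
  \<open>\<integral> t\<^sup>\<beta>\<^sup>-\<^sup>1 L d\<lambda> \<le> C K\<close>; the middle slice itself, on which \<open>w\<close> need not vanish, is controlled by
  the Poincare inequality in \<open>x'\<close>. Hoelder's inequality combines these bounds with
  \<open>\<integral> t\<^sup>\<alpha> P d\<lambda> \<le> K\<close>; for \<open>e = 1/(m + A)\<close> all powers of \<open>t\<close> cancel and
  \<open>\<integral> t\<^sup>\<alpha> w\<^sup>1\<^sup>+\<^sup>e \<le> (C K)\<^sup>1\<^sup>+\<^sup>e\<close> results (\<open>weighted_gagliardo_nirenberg\<close>). The pointwise bound alone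
  would lose a logarithm here; the Hardy inequality repairs this.

  Now take \<open>w = \<bar>f\<bar>\<^sup>k\<close> with \<open>k = 2/(1 - e)\<close>, so that \<open>k (1 + e) = 2k - 2 = Q_cr\<close>. With
  \<open>X = \<integral> t\<^sup>\<alpha> \<bar>f\<bar>\<^sup>Q\<close> for \<open>Q = Q_cr\<close> and \<open>E\<close> the energy, the Cauchy-Schwarz inequality gives
  \<open>K \<le> c X\<^sup>1\<^sup>/\<^sup>2 E\<^sup>1\<^sup>/\<^sup>2\<close> (\<open>K_abs_powr_le\<close>), and since \<open>X\<close> is finite it can be absorbed in
  \<open>X \<le> (C K)\<^sup>1\<^sup>+\<^sup>e\<close> (\<open>ennreal_self_absorption\<close>). Smaller exponents follow because the weight has
  finite mass on the cylinder. The case \<open>Q = 2\<close>, for every \<open>\<sigma>\<close>, is the same argument with \<open>k = 2\<close>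
  and the Poincare inequality in place of the interpolation.

  For \<open>\<sigma> = 2\<close> the substitution \<open>t \<mapsto> t/\<tau>\<close> multiplies the energy and \<open>\<integral> t\<^sup>\<alpha> \<bar>f\<bar>\<^sup>Q\<close> by the same factor
  \<open>\<tau>\<^sup>\<alpha>\<^sup>+\<^sup>1\<close>. Hence a bump living at \<open>\<tau> < t < 2\<tau>\<close> turns the inequality into
  \<open>1 \<le> C \<tau>\<^sup>(\<^sup>\<alpha>\<^sup>+\<^sup>1\<^sup>)\<^sup>(\<^sup>1\<^sup>-\<^sup>2\<^sup>/\<^sup>Q\<^sup>)\<close>, which is false for small \<open>\<tau>\<close> when \<open>Q > 2\<close>.
\<close>

section \<open>Powers and the Hoelder inequality in the extended half-line\<close>

lemma ennreal_powr_ennreal [simp]: "0 \<le> x \<Longrightarrow> ennreal_powr (ennreal x) p = ennreal (x powr p)"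
  by (simp add: ennreal_powr_def)

lemma ennreal_powr_top [simp]: "ennreal_powr \<infinity> p = \<infinity>" "ennreal_powr top p = top"
  by (simp_all add: ennreal_powr_def)

lemma ennreal_powr_0 [simp]: "ennreal_powr 0 p = 0"
  by (simp add: ennreal_powr_def)

lemma ennreal_powr_1 [simp]: "ennreal_powr a 1 = a"
  by (cases a) (auto simp: ennreal_powr_def)

lemma ennreal_powr_eq_0_iff [simp]: "ennreal_powr a p = 0 \<longleftrightarrow> a = 0"
  by (cases a) (auto simp: ennreal_powr_def ennreal_eq_0_iff zero_ennreal.rep_eq)

lemma ennreal_powr_mono: "0 \<le> p \<Longrightarrow> a \<le> b \<Longrightarrow> ennreal_powr a p \<le> ennreal_powr b p"
  by (cases a; cases b) (auto simp: ennreal_powr_def top_unique intro!: ennreal_leI powr_mono2)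

lemma ennreal_powr_add: "ennreal_powr a (p + q) = ennreal_powr a p * ennreal_powr a q"
  by (cases a) (auto simp: powr_add ennreal_mult ennreal_top_mult)

lemma ennreal_powr_powr: "ennreal_powr (ennreal_powr a p) q = ennreal_powr a (p * q)"
  by (cases a) (auto simp: powr_powr)

lemma ennreal_powr_mult: "ennreal_powr (a * b) p = ennreal_powr a p * ennreal_powr b p"
proof (cases "a = 0 \<or> b = 0 \<or> a = top \<or> b = top")
  case True
  then show ?thesis
    by (auto simp: ennreal_top_mult ennreal_mult_top)
next
  case False
  then obtain x y where "a = ennreal x" "b = ennreal y" "x \<ge> 0" "y \<ge> 0"
    by (metis ennreal_cases)
  then show ?thesis
    by (simp add: powr_mult flip: ennreal_mult)
qed

lemma measurable_ennreal_powr [measurable]: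
  assumes [measurable]: "f \<in> borel_measurable M"
  shows "(\<lambda>x. ennreal_powr (f x) p) \<in> borel_measurable M"
proof -
  have "{x \<in> space M. f x = \<infinity>} = f -` {\<infinity>} \<inter> space M"
    by auto
  then have [measurable]: "{x \<in> space M. f x = \<infinity>} \<in> sets M"
    by simp
  show ?thesis
    unfolding ennreal_powr_def by measurable
qed

lemma Youngs_inequality_scaled:
  fixes x y a b t :: real
  assumes "0 < t" "t < 1" "0 \<le> x" "0 \<le> y" "0 < a" "0 < b"
  shows "x powr t * y powr (1 - t)
    \<le> (a powr t * b powr (1 - t)) * (t / a * x + (1 - t) / b * y)"
proof (cases "x = 0 \<or> y = 0")
  case True
  then show ?thesis
    using assms by auto
next
  case False
  have "(x / a) powr t * (y / b) powr (1 - t) \<le> t * (x / a) + (1 - t) * (y / b)"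
    using assms False by (intro Youngs_inequality_0) auto
  then have "(a powr t * b powr (1 - t)) * ((x / a) powr t * (y / b) powr (1 - t))
      \<le> (a powr t * b powr (1 - t)) * (t * (x / a) + (1 - t) * (y / b))"
    by (intro mult_left_mono) auto
  then show ?thesis
    using assms False by (simp add: powr_divide field_simps)
qed

text \<open>Both sides are homogeneous of degree \<open>t\<close> in \<open>F\<close> and \<open>1 - t\<close> in \<open>G\<close>, so the pointwise Young
  inequality is used in the form normalised by the two integrals. Zero and infinite integrals are
  separated first, where the conventions \<open>0 \<cdot> \<infinity> = 0\<close> and \<open>\<infinity>\<^sup>t = \<infinity>\<close> decide.\<close>

lemma nn_integral_Holder:
  assumes [measurable]: "F \<in> borel_measurable M" "G \<in> borel_measurable M"
    and t: "0 < t" "t < 1"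
  shows "(\<integral>\<^sup>+x. ennreal_powr (F x) t * ennreal_powr (G x) (1 - t) \<partial>M)
    \<le> ennreal_powr (\<integral>\<^sup>+x. F x \<partial>M) t * ennreal_powr (\<integral>\<^sup>+x. G x \<partial>M) (1 - t)"
    (is "?L \<le> ennreal_powr ?F t * ennreal_powr ?G (1 - t)")
proof -
  consider "?F = 0" | "?G = 0" | "?F \<noteq> 0" "?G \<noteq> 0" "?F = top \<or> ?G = top"
    | "?F \<noteq> 0" "?G \<noteq> 0" "?F \<noteq> top" "?G \<noteq> top"
    by blast
  then show ?thesis
  proof cases
    case 1
    then have "AE x in M. F x = 0"
      by (simp add: nn_integral_0_iff_AE)
    then have "AE x in M. ennreal_powr (F x) t * ennreal_powr (G x) (1 - t) = 0"
      by eventually_elim simp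
    then have "?L = 0"
      by (simp add: nn_integral_0_iff_AE)
    then show ?thesis by simp
  next
    case 2
    then have "AE x in M. G x = 0"
      by (simp add: nn_integral_0_iff_AE)
    then have "AE x in M. ennreal_powr (F x) t * ennreal_powr (G x) (1 - t) = 0"
      by eventually_elim simp
    then have "?L = 0"
      by (simp add: nn_integral_0_iff_AE)
    then show ?thesis by simp
  next
    case 3
    then have "ennreal_powr ?F t * ennreal_powr ?G (1 - t) = top"
      by (auto simp: ennreal_mult_eq_top_iff)
    then show ?thesis by simp
  next
    case pos: 4
    define a b where "a = enn2real ?F" and "b = enn2real ?G"
    have 4: "?F = ennreal a" "?G = ennreal b" "0 < a" "0 < b"
      using pos by (auto simp: a_def b_def enn2real_positive_iff less_top zero_less_iff_neq_zero)
    define k where "k = a powr t * b powr (1 - t)"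
    have k: "k > 0" using 4 by (simp add: k_def)
    have "?L \<le> (\<integral>\<^sup>+x. ennreal (k * t / a) * F x + ennreal (k * (1 - t) / b) * G x \<partial>M)"
    proof (intro nn_integral_mono)
      fix x
      show "ennreal_powr (F x) t * ennreal_powr (G x) (1 - t)
        \<le> ennreal (k * t / a) * F x + ennreal (k * (1 - t) / b) * G x"
      proof (cases "F x = top \<or> G x = top")
        case True
        then have "ennreal (k * t / a) * F x + ennreal (k * (1 - t) / b) * G x = top"
          using k t 4 by (auto simp: ennreal_mult_eq_top_iff ennreal_eq_0_iff not_le)
        then show ?thesis by (simp only: top_greatest)
      next
        case False
        then obtain u v where uv: "F x = ennreal u" "G x = ennreal v" "0 \<le> u" "0 \<le> v"
          by (metis ennreal_cases)
        have "u powr t * v powr (1 - t) \<le> k * (t / a * u + (1 - t) / b * v)"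
          unfolding k_def using t uv 4 by (intro Youngs_inequality_scaled) auto
        also have "\<dots> = k * t / a * u + k * (1 - t) / b * v"
          by (simp add: algebra_simps)
        finally show ?thesis
          using t uv k 4 by (simp flip: ennreal_mult ennreal_plus)
      qed
    qed
    also have "\<dots> = ennreal (k * t / a) * ennreal a + ennreal (k * (1 - t) / b) * ennreal b"
      using 4 by (simp add: nn_integral_add nn_integral_cmult)
    also have "\<dots> = ennreal (k * t / a * a + k * (1 - t) / b * b)"
      using t k 4 by (simp flip: ennreal_mult ennreal_plus)
    also have "k * t / a * a + k * (1 - t) / b * b = k"
      using 4 by (simp add: field_simps)
    also have "ennreal k = ennreal_powr ?F t * ennreal_powr ?G (1 - t)"
      using 4 by (simp add: k_def flip: ennreal_mult)
    finally show ?thesis .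
  qed
qed

section \<open>The unweighted Gagliardo-Nirenberg inequality\<close>

interpretation lborel_PiM: product_sigma_finite "\<lambda>_. lborel :: real measure"
  by standard

text \<open>The functions \<open>h i\<close> play the role of \<open>\<bar>\<partial>\<^sub>i g\<bar>\<close>, whose integral along a line in direction \<open>i\<close> dominates
  a compactly supported \<open>g\<close> on that line. Keeping the factor
  \<open>(\<integral>g)\<^sup>1\<^sup>/\<^sup>m\<close> on the right makes the induction on the number \<open>m\<close> of coordinates work: on slices
  orthogonal to a new direction \<open>j\<close> this factor is at most the \<open>1/m\<close>-th power of \<open>\<integral>h j\<close>, and
  integrating over the slices gives the Sobolev inequality \<open>\<integral>g\<^sup>1\<^sup>+\<^sup>1\<^sup>/\<^sup>m \<le> P\<^sup>1\<^sup>+\<^sup>1\<^sup>/\<^sup>m\<close> in dimension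
  \<open>m + 1\<close>, from which Hoelder recovers the statement.\<close>

lemma gagliardo_nirenberg_PiM:
  fixes g :: "('i \<Rightarrow> real) \<Rightarrow> ennreal" and h :: "'i \<Rightarrow> ('i \<Rightarrow> real) \<Rightarrow> ennreal"
  assumes "finite I" "I \<noteq> {}"
    and "g \<in> borel_measurable (\<Pi>\<^sub>M i\<in>I. lborel)"
    and "\<And>i. i \<in> I \<Longrightarrow> h i \<in> borel_measurable (\<Pi>\<^sub>M i\<in>I. lborel)"
    and "\<And>i x. i \<in> I \<Longrightarrow> g x \<le> (\<integral>\<^sup>+y. h i (x(i := y)) \<partial>lborel)"
  shows "(\<integral>\<^sup>+x. ennreal_powr (g x) (1 + 1 / card I) \<partial>(\<Pi>\<^sub>M i\<in>I. lborel))
    \<le> (\<Sum>i\<in>I. \<integral>\<^sup>+x. h i x \<partial>(\<Pi>\<^sub>M i\<in>I. lborel))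
      * ennreal_powr (\<integral>\<^sup>+x. g x \<partial>(\<Pi>\<^sub>M i\<in>I. lborel)) (1 / card I)"
  using assms
proof (induction I arbitrary: g h rule: finite_ne_induct)
  case (singleton j)
  let ?M = "\<Pi>\<^sub>M i\<in>{j}. lborel :: real measure"
  note [measurable] = singleton(1,2)
  have le: "g x \<le> (\<integral>\<^sup>+x. h j x \<partial>?M)" if "x \<in> space ?M" for x
  proof -
    have "g x \<le> (\<integral>\<^sup>+y. h j (x(j := y)) \<partial>lborel)"
      by (rule singleton(3)) simp
    also have "\<dots> = (\<integral>\<^sup>+x. h j x \<partial>?M)"
      using that singleton(2)[of j]
      by (subst lborel_PiM.product_nn_integral_insert)
        (auto simp: PiM_empty nn_integral_count_space_finite space_PiM PiE_def extensional_def
              intro!: nn_integral_cong arg_cong[where f="h j"])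
    finally show ?thesis .
  qed
  have "(\<integral>\<^sup>+x. ennreal_powr (g x) (1 + 1) \<partial>?M) \<le> (\<integral>\<^sup>+x. (\<integral>\<^sup>+x. h j x \<partial>?M) * g x \<partial>?M)"
    unfolding ennreal_powr_add by (intro nn_integral_mono) (auto intro!: mult_right_mono le)
  also have "\<dots> = (\<integral>\<^sup>+x. h j x \<partial>?M) * (\<integral>\<^sup>+x. g x \<partial>?M)"
    by (simp add: nn_integral_cmult)
  finally show ?case
    by simp
next
  case (insert j I)
  let ?N = "\<Pi>\<^sub>M i\<in>insert j I. lborel :: real measure"
  let ?M = "\<Pi>\<^sub>M i\<in>I. lborel :: real measure"
  define m where "m = real (card I)"
  have m: "m \<ge> 1"
    using insert.hyps by (simp add: m_def Suc_leI card_gt_0_iff)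
  have [measurable]: "g \<in> borel_measurable ?N" "\<And>i. i \<in> insert j I \<Longrightarrow> h i \<in> borel_measurable ?N"
    using insert.prems by auto
  have upd [measurable]: "(\<lambda>x. x(j := s)) \<in> measurable ?M ?N" for s
    by (rule measurable_fun_upd[where J=I]) auto
  have split: "(\<integral>\<^sup>+x. f x \<partial>?N) = (\<integral>\<^sup>+s. (\<integral>\<^sup>+x. f (x(j := s)) \<partial>?M) \<partial>lborel)"
    if "f \<in> borel_measurable ?N" for f
    using insert.hyps that by (intro lborel_PiM.product_nn_integral_insert_rev) auto
  define P where "P = (\<Sum>i\<in>insert j I. \<integral>\<^sup>+x. h i x \<partial>?N)"
  define Q where "Q = (\<Sum>i\<in>I. \<integral>\<^sup>+x. h i x \<partial>?N)"
  have Q: "Q \<le> P"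
    unfolding P_def Q_def using insert.hyps by (simp add: add_increasing)
  \<comment> \<open>Slicewise, the mass of \<open>g\<close> is at most the \<open>j\<close>-th term of the sum.\<close>
  have mass: "(\<integral>\<^sup>+x. g (x(j := s)) \<partial>?M) \<le> P" for s
  proof -
    have "(\<integral>\<^sup>+x. g (x(j := s)) \<partial>?M) \<le> (\<integral>\<^sup>+x. (\<integral>\<^sup>+y. h j (x(j := y)) \<partial>lborel) \<partial>?M)"
    proof (intro nn_integral_mono)
      fix x show "g (x(j := s)) \<le> (\<integral>\<^sup>+y. h j (x(j := y)) \<partial>lborel)"
        using insert.prems(3)[of j "x(j := s)"] by (simp only: fun_upd_upd insertI1)
    qed
    also have "\<dots> = (\<integral>\<^sup>+x. h j x \<partial>?N)"
      using insert.hyps by (subst lborel_PiM.product_nn_integral_insert) auto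
    also have "\<dots> \<le> P"
      unfolding P_def using insert.hyps by simp
    finally show ?thesis .
  qed
  have "(\<integral>\<^sup>+x. ennreal_powr (g x) (1 + 1 / m) \<partial>?N)
      = (\<integral>\<^sup>+s. (\<integral>\<^sup>+x. ennreal_powr (g (x(j := s))) (1 + 1 / m) \<partial>?M) \<partial>lborel)"
    by (intro split) auto
  also have "\<dots> \<le> (\<integral>\<^sup>+s. (\<Sum>i\<in>I. \<integral>\<^sup>+x. h i (x(j := s)) \<partial>?M) * ennreal_powr P (1 / m) \<partial>lborel)"
  proof (intro nn_integral_mono)
    fix s :: real
    have "(\<integral>\<^sup>+x. ennreal_powr (g (x(j := s))) (1 + 1 / card I) \<partial>?M)
      \<le> (\<Sum>i\<in>I. \<integral>\<^sup>+x. h i (x(j := s)) \<partial>?M)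
          * ennreal_powr (\<integral>\<^sup>+x. g (x(j := s)) \<partial>?M) (1 / card I)"
    proof (rule insert.IH)
      fix i x assume "i \<in> I"
      then have "i \<noteq> j" using insert.hyps by auto
      then have twist: "(x(i := y))(j := s) = (x(j := s))(i := y)" for y
        by (rule fun_upd_twist)
      show "g (x(j := s)) \<le> (\<integral>\<^sup>+y. h i ((x(i := y))(j := s)) \<partial>lborel)"
        unfolding twist using \<open>i \<in> I\<close> by (intro insert.prems(3) insertI2)
    qed (auto intro!: measurable_compose[OF upd] insert.prems simp del: fun_upd_apply)
    also have "\<dots> \<le> (\<Sum>i\<in>I. \<integral>\<^sup>+x. h i (x(j := s)) \<partial>?M) * ennreal_powr P (1 / card I)"
      by (intro mult_left_mono ennreal_powr_mono mass) auto
    finally show "(\<integral>\<^sup>+x. ennreal_powr (g (x(j := s))) (1 + 1 / m) \<partial>?M)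
      \<le> (\<Sum>i\<in>I. \<integral>\<^sup>+x. h i (x(j := s)) \<partial>?M) * ennreal_powr P (1 / m)"
      by (simp add: m_def)
  qed
  also have "\<dots> = Q * ennreal_powr P (1 / m)"
  proof -
    have [measurable]: "(\<lambda>s. \<integral>\<^sup>+x. h i (x(j := s)) \<partial>?M) \<in> borel_measurable lborel" if "i \<in> I" for i
    proof -
      interpret finite_product_sigma_finite "\<lambda>_. lborel :: real measure" I
        using insert.hyps by unfold_locales
      have [measurable]: "h i \<in> borel_measurable ?N" using that by auto
      have "(\<lambda>p. (snd p)(j := fst p)) \<in> measurable (lborel \<Otimes>\<^sub>M ?M) ?N"
        by (rule measurable_fun_upd[where J=I]) auto
      from measurable_compose[OF this, of "h i" borel] show ?thesis
        by (intro borel_measurable_nn_integral) (auto simp: split_beta')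
    qed
    show ?thesis
      unfolding Q_def
      by (subst nn_integral_multc) (auto simp: nn_integral_sum split)
  qed
  also have "\<dots> \<le> P * ennreal_powr P (1 / m)"
    by (intro mult_right_mono Q) auto
  also have "\<dots> = ennreal_powr P (1 + 1 / m)"
    by (simp add: ennreal_powr_add)
  finally have strong: "(\<integral>\<^sup>+x. ennreal_powr (g x) (1 + 1 / m) \<partial>?N) \<le> ennreal_powr P (1 + 1 / m)" .
  \<comment> \<open>Interpolating between the mass of \<open>g\<close> and the Sobolev inequality in dimension \<open>m + 1\<close>.\<close>
  define t where "t = 1 / (m + 1)"
  have t: "0 < t" "t < 1" "(1 + 1 / m) * (1 - t) = 1"
    using m add_pos_nonneg[of m "m * m"] by (auto simp: t_def field_simps)
  have "(\<integral>\<^sup>+x. ennreal_powr (g x) (1 + t) \<partial>?N)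
      = (\<integral>\<^sup>+x. ennreal_powr (g x) t * ennreal_powr (ennreal_powr (g x) (1 + 1 / m)) (1 - t) \<partial>?N)"
    unfolding ennreal_powr_powr t by (simp add: ennreal_powr_add mult.commute)
  also have "\<dots> \<le> ennreal_powr (\<integral>\<^sup>+x. g x \<partial>?N) t
      * ennreal_powr (\<integral>\<^sup>+x. ennreal_powr (g x) (1 + 1 / m) \<partial>?N) (1 - t)"
    using t by (intro nn_integral_Holder) auto
  also have "\<dots> \<le> ennreal_powr (\<integral>\<^sup>+x. g x \<partial>?N) t
      * ennreal_powr (ennreal_powr P (1 + 1 / m)) (1 - t)"
    using t by (intro mult_left_mono ennreal_powr_mono strong) auto
  also have "\<dots> = P * ennreal_powr (\<integral>\<^sup>+x. g x \<partial>?N) t"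
    unfolding ennreal_powr_powr t by (simp add: mult.commute)
  also have "t = 1 / card (insert j I)"
    using insert.hyps by (simp add: t_def m_def)
  finally show ?case
    unfolding P_def .
qed

text \<open>The coordinate version transported along the measure-preserving map \<open>w \<mapsto> \<Sum>b. w b *\<^sub>R b\<close>.\<close>

lemma gagliardo_nirenberg_lborel:
  fixes g :: "'a::euclidean_space \<Rightarrow> ennreal" and h :: "'a \<Rightarrow> 'a \<Rightarrow> ennreal"
  assumes [measurable]: "g \<in> borel_measurable borel"
    and h [measurable]: "\<And>b. b \<in> Basis \<Longrightarrow> h b \<in> borel_measurable borel"
    and le: "\<And>b x. b \<in> Basis \<Longrightarrow> g x \<le> (\<integral>\<^sup>+z. h b (x + z *\<^sub>R b) \<partial>lborel)"
  shows "(\<integral>\<^sup>+x. ennreal_powr (g x) (1 + 1 / DIM('a)) \<partial>lborel)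
    \<le> (\<Sum>b\<in>Basis. \<integral>\<^sup>+x. h b x \<partial>lborel) * ennreal_powr (\<integral>\<^sup>+x. g x \<partial>lborel) (1 / DIM('a))"
proof -
  let ?M = "\<Pi>\<^sub>M b\<in>(Basis::'a set). lborel :: real measure"
  let ?e = "\<lambda>w::'a \<Rightarrow> real. \<Sum>b\<in>Basis. w b *\<^sub>R b"
  have int: "(\<integral>\<^sup>+x. f x \<partial>lborel) = (\<integral>\<^sup>+w. f (?e w) \<partial>?M)" if "f \<in> borel_measurable borel" for f :: "'a \<Rightarrow> ennreal"
    using that by (subst lborel_eq) (simp add: nn_integral_distr)
  have "(\<integral>\<^sup>+w. ennreal_powr (g (?e w)) (1 + 1 / card (Basis::'a set)) \<partial>?M)
    \<le> (\<Sum>b\<in>Basis. \<integral>\<^sup>+w. h b (?e w) \<partial>?M) * ennreal_powr (\<integral>\<^sup>+w. g (?e w) \<partial>?M) (1 / card (Basis::'a set))"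
  proof (rule gagliardo_nirenberg_PiM)
    fix b :: 'a and w :: "'a \<Rightarrow> real" assume b: "b \<in> Basis"
    have e: "?e (w(b := y)) = ?e w + (y - w b) *\<^sub>R b" for y
    proof -
      have "?e w = w b *\<^sub>R b + (\<Sum>c\<in>Basis - {b}. w c *\<^sub>R c)"
        using b by (intro sum.remove) auto
      moreover have "?e (w(b := y)) = y *\<^sub>R b + (\<Sum>c\<in>Basis - {b}. (w(b := y)) c *\<^sub>R c)"
        using b by (subst sum.remove[of _ b]) auto
      moreover have "(\<Sum>c\<in>Basis - {b}. (w(b := y)) c *\<^sub>R c) = (\<Sum>c\<in>Basis - {b}. w c *\<^sub>R c)"
        by (intro sum.cong) auto
      ultimately show ?thesis
        by (simp add: algebra_simps)
    qed
    have [measurable]: "h b \<in> borel_measurable borel"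
      using b by (rule h)
    have "g (?e w) \<le> (\<integral>\<^sup>+z. h b (?e w + z *\<^sub>R b) \<partial>lborel)"
      by (rule le[OF b])
    also have "\<dots> = (\<integral>\<^sup>+y. h b (?e w + (- w b + 1 * y) *\<^sub>R b) \<partial>lborel)"
      by (subst nn_integral_real_affine[where c=1 and t="- w b"]) auto
    finally show "g (?e w) \<le> (\<integral>\<^sup>+y. h b (?e (w(b := y))) \<partial>lborel)"
      unfolding e by (simp add: algebra_simps)
  qed auto
  then show ?thesis
    using h by (simp add: int)
qed

section \<open>Power weights at the ends of an interval\<close>

text \<open>This is \<open>(1 - \<bar>l\<bar>)\<^sup>k\<close>, cut off to the open interval so that integrals against it may be taken over
  the whole line.\<close>

definition bdry_weight :: "real \<Rightarrow> real \<Rightarrow> ennreal" where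
  "bdry_weight k l = ennreal ((1 - \<bar>l\<bar>) powr k) * indicator {-1<..<1} l"

lemma measurable_bdry_weight [measurable]: "bdry_weight k \<in> borel_measurable borel"
  unfolding bdry_weight_def by measurable

lemma bdry_weight_inside: "\<bar>l\<bar> < 1 \<Longrightarrow> bdry_weight k l = ennreal ((1 - \<bar>l\<bar>) powr k)"
  by (auto simp: bdry_weight_def indicator_def)

lemma bdry_weight_outside: "\<not> \<bar>l\<bar> < 1 \<Longrightarrow> bdry_weight k l = 0"
  by (auto simp: bdry_weight_def indicator_def)

lemma bdry_weight_antimono_exponent: "j \<le> k \<Longrightarrow> bdry_weight k l \<le> bdry_weight j l"
  by (cases "\<bar>l\<bar> < 1") (auto simp: bdry_weight_inside bdry_weight_outside intro!: ennreal_leI powr_mono')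

lemma bdry_weight_antimono: "0 \<le> k \<Longrightarrow> \<bar>r\<bar> \<le> \<bar>l\<bar> \<Longrightarrow> bdry_weight k l \<le> bdry_weight k r"
  by (cases "\<bar>l\<bar> < 1") (auto simp: bdry_weight_inside bdry_weight_outside intro!: ennreal_leI powr_mono2)

lemma bdry_weight_0 [simp]: "bdry_weight k 0 = 1"
  by (simp add: bdry_weight_inside)

lemma nn_integral_powr_one_sided:
  fixes r k :: real
  assumes "0 \<le> r" "r \<le> 1" "0 < k"
  shows "(\<integral>\<^sup>+l. ennreal ((1 - l) powr (k - 1)) * indicator {r..1} l \<partial>lborel) = ennreal ((1 - r) powr k / k)"
proof -
  have "(\<integral>\<^sup>+l. ennreal ((1 - l) powr (k - 1)) * indicator {r..1} l \<partial>lborel)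
      = (\<integral>\<^sup>+s. ennreal ((1 - (1 + (-1) * s)) powr (k - 1)) * indicator {r..1} (1 + (-1) * s) \<partial>lborel)"
    by (subst nn_integral_real_affine[where c="-1" and t=1]) auto
  also have "\<dots> = (\<integral>\<^sup>+s. ennreal (s powr (k - 1)) * indicator {0..1 - r} s \<partial>lborel)"
    by (intro nn_integral_cong) (auto simp: indicator_def)
  also have "\<dots> = ennreal ((1 - r) powr (k - 1 + 1) / (k - 1 + 1))"
  proof (rule nn_integral_has_integral_lebesgue')
    show "((\<lambda>s. s powr (k - 1)) has_integral (1 - r) powr (k - 1 + 1) / (k - 1 + 1)) {0..1 - r}"
      using assms by (intro has_integral_powr_from_0) auto
  qed auto
  finally show ?thesis by simp
qed

lemma bdry_weight_tail:
  assumes k: "0 < k"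
  shows "(\<integral>\<^sup>+l. bdry_weight (k - 1) l * indicator {l. \<bar>m\<bar> \<le> \<bar>l\<bar>} l \<partial>lborel)
    \<le> ennreal (2 / k) * bdry_weight k m"
proof (cases "\<bar>m\<bar> < 1")
  case False
  then have "(\<integral>\<^sup>+l. bdry_weight (k - 1) l * indicator {l. \<bar>m\<bar> \<le> \<bar>l\<bar>} l \<partial>lborel) = (\<integral>\<^sup>+(l::real). 0 \<partial>lborel)"
    by (intro nn_integral_cong) (auto simp: bdry_weight_def indicator_def)
  then show ?thesis
    by simp
next
  case True
  let ?f = "\<lambda>l. ennreal ((1 - l) powr (k - 1)) * indicator {\<bar>m\<bar>..1} l"
  have "(\<integral>\<^sup>+l. bdry_weight (k - 1) l * indicator {l. \<bar>m\<bar> \<le> \<bar>l\<bar>} l \<partial>lborel)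
      \<le> (\<integral>\<^sup>+l. ?f l + ?f (0 + (-1) * l) \<partial>lborel)"
    by (intro nn_integral_mono) (auto simp: bdry_weight_def indicator_def)
  also have "\<dots> = (\<integral>\<^sup>+l. ?f l \<partial>lborel) + (\<integral>\<^sup>+l. ?f (0 + (-1) * l) \<partial>lborel)"
    by (intro nn_integral_add) auto
  also have "(\<integral>\<^sup>+l. ?f (0 + (-1) * l) \<partial>lborel) = (\<integral>\<^sup>+l. ?f l \<partial>lborel)"
    by (subst nn_integral_real_affine[where c="-1" and t=0 and f="?f"]) auto
  also have "(\<integral>\<^sup>+l. ?f l \<partial>lborel) = ennreal ((1 - \<bar>m\<bar>) powr k / k)"
    using True k by (intro nn_integral_powr_one_sided) auto
  also have "\<dots> + \<dots> = ennreal (2 / k) * bdry_weight k m"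
    using True k by (simp add: bdry_weight_inside flip: ennreal_mult ennreal_plus)
  finally show ?thesis .
qed

lemma bdry_weight_mass_le:
  assumes k: "0 < k"
  shows "(\<integral>\<^sup>+l. bdry_weight (k - 1) l \<partial>lborel) \<le> ennreal (2 / k)"
  using bdry_weight_tail[OF k, of 0] by simp

lemma bdry_weight_mass_ge:
  assumes k: "0 < k"
  shows "ennreal (1 / k) \<le> (\<integral>\<^sup>+l. bdry_weight (k - 1) l \<partial>lborel)"
proof -
  have "ennreal (1 / k) = (\<integral>\<^sup>+l. ennreal ((1 - l) powr (k - 1)) * indicator {0..1} l \<partial>lborel)"
    using k by (subst nn_integral_powr_one_sided) auto
  also have "\<dots> \<le> (\<integral>\<^sup>+l. bdry_weight (k - 1) l \<partial>lborel)"
    by (intro nn_integral_mono) (auto simp: bdry_weight_def indicator_def)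
  finally show ?thesis .
qed

lemma indicator_abs_le_abs:
  fixes l m :: real
  shows "indicator {m. \<bar>m\<bar> \<le> \<bar>l\<bar>} m = (if \<bar>l\<bar> < \<bar>m\<bar> then 0 else 1 :: ennreal)"
    and "indicator {l. \<bar>m\<bar> \<le> \<bar>l\<bar>} l = (if \<bar>l\<bar> < \<bar>m\<bar> then 0 else 1 :: ennreal)"
  by (simp_all add: indicator_def)

lemma measurable_symmetric_interval_integral:
  fixes T :: "real \<Rightarrow> ennreal"
  assumes [measurable]: "T \<in> borel_measurable borel"
  shows "(\<lambda>l. \<integral>\<^sup>+m. T m * indicator {m. \<bar>m\<bar> \<le> \<bar>l\<bar>} m \<partial>lborel) \<in> borel_measurable borel"
  unfolding indicator_abs_le_abs by measurable

text \<open>Exchanging the integrals leaves the weight of exponent \<open>k - 1\<close> on \<open>\<bar>m\<bar> \<le> \<bar>l\<bar> < 1\<close>, whose mass is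
  comparable to the weight of exponent \<open>k\<close> at \<open>m\<close>. This gain of one power is Hardy's inequality.\<close>

lemma bdry_weight_Tonelli:
  assumes [measurable]: "T \<in> borel_measurable borel" and k: "0 < k"
  shows "(\<integral>\<^sup>+l. bdry_weight (k - 1) l * (\<integral>\<^sup>+m. T m * indicator {m. \<bar>m\<bar> \<le> \<bar>l\<bar>} m \<partial>lborel) \<partial>lborel)
    \<le> ennreal (2 / k) * (\<integral>\<^sup>+m. bdry_weight k m * T m \<partial>lborel)"
proof -
  have "(\<integral>\<^sup>+l. bdry_weight (k - 1) l * (\<integral>\<^sup>+m. T m * indicator {m. \<bar>m\<bar> \<le> \<bar>l\<bar>} m \<partial>lborel) \<partial>lborel)
      = (\<integral>\<^sup>+l. (\<integral>\<^sup>+m. bdry_weight (k - 1) l * (T m * indicator {m. \<bar>m\<bar> \<le> \<bar>l\<bar>} m) \<partial>lborel) \<partial>lborel)"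
    by (intro nn_integral_cong) (simp add: nn_integral_cmult)
  also have "\<dots> = (\<integral>\<^sup>+m. (\<integral>\<^sup>+l. bdry_weight (k - 1) l * (T m * indicator {m. \<bar>m\<bar> \<le> \<bar>l\<bar>} m) \<partial>lborel) \<partial>lborel)"
    unfolding indicator_abs_le_abs by (intro lborel_pair.Fubini') measurable
  also have "\<dots> = (\<integral>\<^sup>+m. T m * (\<integral>\<^sup>+l. bdry_weight (k - 1) l * indicator {l. \<bar>m\<bar> \<le> \<bar>l\<bar>} l \<partial>lborel) \<partial>lborel)"
    by (subst nn_integral_cmult[symmetric]) (auto intro!: nn_integral_cong simp: indicator_def mult.commute)
  also have "\<dots> \<le> (\<integral>\<^sup>+m. T m * (ennreal (2 / k) * bdry_weight k m) \<partial>lborel)"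
    using k by (intro nn_integral_mono mult_left_mono bdry_weight_tail) auto
  also have "\<dots> = ennreal (2 / k) * (\<integral>\<^sup>+m. bdry_weight k m * T m \<partial>lborel)"
    by (subst nn_integral_cmult[symmetric]) (auto intro!: nn_integral_cong simp: mult_ac)
  finally show ?thesis .
qed

text \<open>In the next three lemmas \<open>L\<close> stands for the integral over the slice at height \<open>l\<close> and \<open>T\<close> for a
  bound of \<open>\<bar>L'\<bar>\<close>. The value at the centre is recovered by averaging the bound from the centre against
  the weight, whose total mass is positive and finite because \<open>-1 < a\<close>.\<close>

lemma weighted_trace_bound:
  assumes [measurable]: "L \<in> borel_measurable borel" "T \<in> borel_measurable borel"
    and a: "-1 < a" and b: "b \<le> a + 1"
    and down: "\<And>l. \<bar>l\<bar> < 1 \<Longrightarrow> L 0 \<le> L l + (\<integral>\<^sup>+m. T m * indicator {m. \<bar>m\<bar> \<le> \<bar>l\<bar>} m \<partial>lborel)"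
  shows "L 0 \<le> ennreal (a + 1) * (\<integral>\<^sup>+l. bdry_weight a l * L l \<partial>lborel)
    + 2 * (\<integral>\<^sup>+l. bdry_weight b l * T l \<partial>lborel)"
proof -
  define D where "D = (\<lambda>l. \<integral>\<^sup>+m. T m * indicator {m. \<bar>m\<bar> \<le> \<bar>l\<bar>} m \<partial>lborel)"
  have [measurable]: "D \<in> borel_measurable borel"
    unfolding D_def by (rule measurable_symmetric_interval_integral) measurable
  have "ennreal (1 / (a + 1)) * L 0 \<le> (\<integral>\<^sup>+l. bdry_weight a l \<partial>lborel) * L 0"
    using bdry_weight_mass_ge[of "a + 1"] a by (intro mult_right_mono) auto
  also have "\<dots> = (\<integral>\<^sup>+l. bdry_weight a l * L 0 \<partial>lborel)"
    by (simp add: nn_integral_multc)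
  also have "\<dots> \<le> (\<integral>\<^sup>+l. bdry_weight a l * L l + bdry_weight a l * D l \<partial>lborel)"
  proof (intro nn_integral_mono)
    fix l :: real
    show "bdry_weight a l * L 0 \<le> bdry_weight a l * L l + bdry_weight a l * D l"
      using down[of l] by (cases "\<bar>l\<bar> < 1")
        (auto simp: bdry_weight_outside D_def simp flip: distrib_left intro!: mult_left_mono)
  qed
  also have "\<dots> = (\<integral>\<^sup>+l. bdry_weight a l * L l \<partial>lborel) + (\<integral>\<^sup>+l. bdry_weight (a + 1 - 1) l * D l \<partial>lborel)"
    by (simp add: nn_integral_add)
  also have "\<dots> \<le> (\<integral>\<^sup>+l. bdry_weight a l * L l \<partial>lborel)
      + ennreal (2 / (a + 1)) * (\<integral>\<^sup>+l. bdry_weight (a + 1) l * T l \<partial>lborel)"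
    unfolding D_def using a by (intro add_left_mono bdry_weight_Tonelli) auto
  also have "\<dots> \<le> (\<integral>\<^sup>+l. bdry_weight a l * L l \<partial>lborel)
      + ennreal (2 / (a + 1)) * (\<integral>\<^sup>+l. bdry_weight b l * T l \<partial>lborel)"
    using b by (intro add_left_mono mult_left_mono nn_integral_mono mult_right_mono
        bdry_weight_antimono_exponent) auto
  finally have "ennreal (a + 1) * (ennreal (1 / (a + 1)) * L 0)
    \<le> ennreal (a + 1) * ((\<integral>\<^sup>+l. bdry_weight a l * L l \<partial>lborel)
      + ennreal (2 / (a + 1)) * (\<integral>\<^sup>+l. bdry_weight b l * T l \<partial>lborel))"
    by (intro mult_left_mono) auto
  moreover have "(2 * a + 2) / (a + 1) = 2"
    using a by (simp add: field_simps)
  then have "ennreal (a + 1) * ennreal (1 / (a + 1)) = 1" "ennreal (a + 1) * ennreal (2 / (a + 1)) = 2"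
    using a by (simp_all flip: ennreal_mult add: algebra_simps ennreal_numeral)
  ultimately show ?thesis
    by (simp add: distrib_left flip: mult.assoc)
qed

text \<open>The weight decreases away from the centre, so its value at \<open>l\<close> may be moved inside the integral
  over \<open>\<bar>m\<bar> \<le> \<bar>l\<bar>\<close>.\<close>

lemma weighted_sup_bound:
  assumes [measurable]: "T \<in> borel_measurable borel"
    and b: "0 \<le> b" and l: "\<bar>l\<bar> < 1"
    and up: "L l \<le> L 0 + (\<integral>\<^sup>+m. T m * indicator {m. \<bar>m\<bar> \<le> \<bar>l\<bar>} m \<partial>lborel)"
  shows "bdry_weight b l * L l \<le> L 0 + (\<integral>\<^sup>+m. bdry_weight b m * T m \<partial>lborel)"
proof -
  have "bdry_weight b l * L l \<le> bdry_weight b l * L 0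
      + bdry_weight b l * (\<integral>\<^sup>+m. T m * indicator {m. \<bar>m\<bar> \<le> \<bar>l\<bar>} m \<partial>lborel)"
    using up by (simp flip: distrib_left add: mult_left_mono)
  also have "bdry_weight b l * L 0 \<le> 1 * L 0"
    using bdry_weight_antimono[of b 0 l] b by (intro mult_right_mono) auto
  also have "bdry_weight b l * (\<integral>\<^sup>+m. T m * indicator {m. \<bar>m\<bar> \<le> \<bar>l\<bar>} m \<partial>lborel)
      = (\<integral>\<^sup>+m. bdry_weight b l * (T m * indicator {m. \<bar>m\<bar> \<le> \<bar>l\<bar>} m) \<partial>lborel)"
    by (simp add: nn_integral_cmult)
  also have "\<dots> \<le> (\<integral>\<^sup>+m. bdry_weight b m * T m \<partial>lborel)"
    using bdry_weight_antimono[OF b] by (intro nn_integral_mono) (auto simp: indicator_def intro!: mult_right_mono)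
  finally show ?thesis
    by (simp add: add_mono)
qed

lemma weighted_Hardy_bound:
  assumes [measurable]: "L \<in> borel_measurable borel" "T \<in> borel_measurable borel"
    and b: "0 < b"
    and up: "\<And>l. \<bar>l\<bar> < 1 \<Longrightarrow> L l \<le> L 0 + (\<integral>\<^sup>+m. T m * indicator {m. \<bar>m\<bar> \<le> \<bar>l\<bar>} m \<partial>lborel)"
  shows "(\<integral>\<^sup>+l. bdry_weight (b - 1) l * L l \<partial>lborel)
    \<le> ennreal (2 / b) * (L 0 + (\<integral>\<^sup>+m. bdry_weight b m * T m \<partial>lborel))"
proof -
  define D where "D = (\<lambda>l. \<integral>\<^sup>+m. T m * indicator {m. \<bar>m\<bar> \<le> \<bar>l\<bar>} m \<partial>lborel)"
  have [measurable]: "D \<in> borel_measurable borel"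
    unfolding D_def by (rule measurable_symmetric_interval_integral) measurable
  have "(\<integral>\<^sup>+l. bdry_weight (b - 1) l * L l \<partial>lborel)
    \<le> (\<integral>\<^sup>+l. bdry_weight (b - 1) l * L 0 + bdry_weight (b - 1) l * D l \<partial>lborel)"
  proof (intro nn_integral_mono)
    fix l :: real
    show "bdry_weight (b - 1) l * L l \<le> bdry_weight (b - 1) l * L 0 + bdry_weight (b - 1) l * D l"
      using up[of l] by (cases "\<bar>l\<bar> < 1")
        (auto simp: bdry_weight_outside D_def simp flip: distrib_left intro!: mult_left_mono)
  qed
  also have "\<dots> = (\<integral>\<^sup>+l. bdry_weight (b - 1) l \<partial>lborel) * L 0 + (\<integral>\<^sup>+l. bdry_weight (b - 1) l * D l \<partial>lborel)"
    by (simp add: nn_integral_add nn_integral_multc)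
  also have "\<dots> \<le> ennreal (2 / b) * L 0 + ennreal (2 / b) * (\<integral>\<^sup>+m. bdry_weight b m * T m \<partial>lborel)"
    unfolding D_def using b
    by (intro add_mono mult_right_mono bdry_weight_mass_le bdry_weight_Tonelli) auto
  finally show ?thesis
    by (simp add: distrib_left)
qed

text \<open>The factor \<open>L\<^sup>e\<close> is estimated by the pointwise bound, the remaining \<open>L\<^sup>1\<^sup>-\<^sup>t P\<^sup>t\<close> by Hoelder's inequality. The
  scaling relation says exactly that the weight \<open>a\<close> is the product of the weights \<open>b\<close>, \<open>b - 1\<close> and
  \<open>a\<close> taken to the powers \<open>e\<close>, \<open>1 - t\<close> and \<open>t\<close>.\<close>

lemma nn_integral_slice_interpolation:
  assumes [measurable]: "L \<in> borel_measurable borel" "P \<in> borel_measurable borel"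
    and t: "0 < t" "t < 1" and e: "0 < e"
    and scaling: "a * (1 - t) = b * e + (b - 1) * (1 - t)"
    and sup: "\<And>l. \<bar>l\<bar> < 1 \<Longrightarrow> bdry_weight b l * L l \<le> K"
    and hardy: "(\<integral>\<^sup>+l. bdry_weight (b - 1) l * L l \<partial>lborel) \<le> K"
    and grad: "(\<integral>\<^sup>+l. bdry_weight a l * P l \<partial>lborel) \<le> K"
  shows "(\<integral>\<^sup>+l. bdry_weight a l * (ennreal_powr (L l) (1 - t + e) * ennreal_powr (P l) t) \<partial>lborel)
    \<le> ennreal_powr K (1 + e)"
proof -
  have "(\<integral>\<^sup>+l. bdry_weight a l * (ennreal_powr (L l) (1 - t + e) * ennreal_powr (P l) t) \<partial>lborel)
    \<le> (\<integral>\<^sup>+l. ennreal_powr K e * (ennreal_powr (bdry_weight a l * P l) t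
          * ennreal_powr (bdry_weight (b - 1) l * L l) (1 - t)) \<partial>lborel)"
  proof (intro nn_integral_mono)
    fix l :: real
    show "bdry_weight a l * (ennreal_powr (L l) (1 - t + e) * ennreal_powr (P l) t)
      \<le> ennreal_powr K e * (ennreal_powr (bdry_weight a l * P l) t
          * ennreal_powr (bdry_weight (b - 1) l * L l) (1 - t))"
    proof (cases "\<bar>l\<bar> < 1")
      case True
      \<comment> \<open>The scaling relation, rearranged: the weights on the right multiply up to the one on the left.\<close>
      have exps: "a = b * e + a * t + (b - 1) * (1 - t)"
        using scaling by (simp add: algebra_simps)
      have w: "bdry_weight a l = ennreal_powr (bdry_weight b l) e * ennreal_powr (bdry_weight a l) t
          * ennreal_powr (bdry_weight (b - 1) l) (1 - t)"
        using True by (subst exps) (simp add: bdry_weight_inside powr_powr powr_add flip: ennreal_mult)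
      have "bdry_weight a l * (ennreal_powr (L l) (1 - t + e) * ennreal_powr (P l) t)
        = ennreal_powr (bdry_weight b l * L l) e * (ennreal_powr (bdry_weight a l * P l) t
          * ennreal_powr (bdry_weight (b - 1) l * L l) (1 - t))"
        by (subst w) (simp add: ennreal_powr_mult ennreal_powr_add mult_ac)
      also have "\<dots> \<le> ennreal_powr K e * (ennreal_powr (bdry_weight a l * P l) t
          * ennreal_powr (bdry_weight (b - 1) l * L l) (1 - t))"
        using sup[OF True] e by (intro mult_right_mono ennreal_powr_mono) auto
      finally show ?thesis .
    qed (simp add: bdry_weight_outside)
  qed
  also have "\<dots> = ennreal_powr K e * (\<integral>\<^sup>+l. ennreal_powr (bdry_weight a l * P l) t
          * ennreal_powr (bdry_weight (b - 1) l * L l) (1 - t) \<partial>lborel)"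
    by (simp add: nn_integral_cmult)
  also have "\<dots> \<le> ennreal_powr K e * (ennreal_powr (\<integral>\<^sup>+l. bdry_weight a l * P l \<partial>lborel) t
          * ennreal_powr (\<integral>\<^sup>+l. bdry_weight (b - 1) l * L l \<partial>lborel) (1 - t))"
    using t by (intro mult_left_mono nn_integral_Holder) auto
  also have "\<dots> \<le> ennreal_powr K e * (ennreal_powr K t * ennreal_powr K (1 - t))"
    using t by (intro mult_left_mono mult_mono ennreal_powr_mono grad hardy) auto
  also have "\<dots> = ennreal_powr K (1 + e)"
    by (simp add: ennreal_powr_add[of _ 1 e] mult.commute flip: ennreal_powr_add[of _ t])
  finally show ?thesis .
qed

section \<open>The weighted first-order inequality on the cylinder\<close>

lemma abs_le_abs_plus_nn_integral_deriv:
  fixes u u' :: "real \<Rightarrow> real"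
  assumes deriv: "\<And>s. (u has_real_derivative u' s) (at s)" and cont: "continuous_on UNIV u'"
    and ab: "a \<le> b"
  shows "ennreal \<bar>u b\<bar> \<le> ennreal \<bar>u a\<bar> + (\<integral>\<^sup>+s. ennreal \<bar>u' s\<bar> * indicator {a..b} s \<partial>lborel)"
    and "ennreal \<bar>u a\<bar> \<le> ennreal \<bar>u b\<bar> + (\<integral>\<^sup>+s. ennreal \<bar>u' s\<bar> * indicator {a..b} s \<partial>lborel)"
proof -
  have isCont: "isCont u' s" for s
    using cont by (simp add: continuous_on_eq_continuous_at)
  have "has_bochner_integral lborel (\<lambda>s. u' s * indicator {a..b} s) (u b - u a)"
    using deriv isCont ab by (intro has_bochner_integral_FTC_Icc_real) auto
  then have "norm (u b - u a) \<le> (\<integral>\<^sup>+s. norm (u' s * indicator {a..b} s) \<partial>lborel)"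
    by (rule has_bochner_integral_norm_bound)
  also have "\<dots> = (\<integral>\<^sup>+s. ennreal \<bar>u' s\<bar> * indicator {a..b} s \<partial>lborel)"
    by (intro nn_integral_cong) (auto simp: indicator_def)
  finally have *: "ennreal \<bar>u b - u a\<bar> \<le> (\<integral>\<^sup>+s. ennreal \<bar>u' s\<bar> * indicator {a..b} s \<partial>lborel)"
    by simp
  have "ennreal \<bar>u b\<bar> \<le> ennreal \<bar>u a\<bar> + ennreal \<bar>u b - u a\<bar>"
    by (simp flip: ennreal_plus)
  also note add_left_mono[OF *]
  finally show "ennreal \<bar>u b\<bar> \<le> ennreal \<bar>u a\<bar> + (\<integral>\<^sup>+s. ennreal \<bar>u' s\<bar> * indicator {a..b} s \<partial>lborel)" .
  have "ennreal \<bar>u a\<bar> \<le> ennreal \<bar>u b\<bar> + ennreal \<bar>u b - u a\<bar>"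
    by (simp flip: ennreal_plus)
  also note add_left_mono[OF *]
  finally show "ennreal \<bar>u a\<bar> \<le> ennreal \<bar>u b\<bar> + (\<integral>\<^sup>+s. ennreal \<bar>u' s\<bar> * indicator {a..b} s \<partial>lborel)" .
qed

lemma nn_integral_translate:
  fixes f :: "'a::euclidean_space \<Rightarrow> ennreal"
  assumes [measurable]: "f \<in> borel_measurable borel"
  shows "(\<integral>\<^sup>+x. f (c + x) \<partial>lborel) = (\<integral>\<^sup>+x. f x \<partial>lborel)"
proof -
  have "(\<integral>\<^sup>+x. f x \<partial>lborel) = (\<integral>\<^sup>+x. f x \<partial>distr lborel borel ((+) c))"
    by (simp only: lborel_distr_plus)
  also have "\<dots> = (\<integral>\<^sup>+x. f (c + x) \<partial>lborel)"
    by (intro nn_integral_distr) auto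
  finally show ?thesis ..
qed

text \<open>Integrating the line bound over the strip \<open>\<bar>x \<bullet> b\<bar> \<le> 1\<close> and translating in \<open>x\<close>, each point is
  counted for those \<open>z\<close> in an interval of length \<open>2\<close>, the width of the strip.\<close>

lemma Poincare_strip:
  fixes g h :: "'a::euclidean_space \<Rightarrow> ennreal"
  assumes [measurable]: "g \<in> borel_measurable borel" "h \<in> borel_measurable borel"
    and b: "b \<in> Basis"
    and le: "\<And>x. g x \<le> (\<integral>\<^sup>+z. h (x + z *\<^sub>R b) \<partial>lborel)"
    and strip: "\<And>x. \<bar>x \<bullet> b\<bar> > 1 \<Longrightarrow> g x = 0"
  shows "(\<integral>\<^sup>+x. g x \<partial>lborel) \<le> 2 * (\<integral>\<^sup>+x. h x \<partial>lborel)"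
proof -
  let ?I = "\<lambda>r. indicator {-1..1::real} r :: ennreal"
  have "(\<integral>\<^sup>+x. g x \<partial>lborel) \<le> (\<integral>\<^sup>+x. (\<integral>\<^sup>+z. ?I (x \<bullet> b) * h (x + z *\<^sub>R b) \<partial>lborel) \<partial>lborel)"
  proof (intro nn_integral_mono)
    fix x
    show "g x \<le> (\<integral>\<^sup>+z. ?I (x \<bullet> b) * h (x + z *\<^sub>R b) \<partial>lborel)"
      using le[of x] strip[of x] by (cases "\<bar>x \<bullet> b\<bar> > 1") (auto simp: indicator_def)
  qed
  also have "\<dots> = (\<integral>\<^sup>+z. (\<integral>\<^sup>+x. ?I (x \<bullet> b) * h (x + z *\<^sub>R b) \<partial>lborel) \<partial>lborel)"
    by (intro lborel_pair.Fubini') (simp add: split_beta')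
  also have "\<dots> = (\<integral>\<^sup>+z. (\<integral>\<^sup>+x. ?I (x \<bullet> b - z) * h x \<partial>lborel) \<partial>lborel)"
  proof (rule nn_integral_cong)
    fix z :: real
    have "(\<integral>\<^sup>+x. ?I (x \<bullet> b - z) * h x \<partial>lborel)
        = (\<integral>\<^sup>+x. ?I ((z *\<^sub>R b + x) \<bullet> b - z) * h (z *\<^sub>R b + x) \<partial>lborel)"
      by (subst nn_integral_translate[where f="\<lambda>x. ?I (x \<bullet> b - z) * h x"]) auto
    also have "\<dots> = (\<integral>\<^sup>+x. ?I (x \<bullet> b) * h (x + z *\<^sub>R b) \<partial>lborel)"
      using b by (simp add: inner_add_left add.commute)
    finally show "(\<integral>\<^sup>+x. ?I (x \<bullet> b) * h (x + z *\<^sub>R b) \<partial>lborel) = (\<integral>\<^sup>+x. ?I (x \<bullet> b - z) * h x \<partial>lborel)" ..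
  qed
  also have "\<dots> = (\<integral>\<^sup>+x. (\<integral>\<^sup>+z. ?I (x \<bullet> b - z) * h x \<partial>lborel) \<partial>lborel)"
    by (intro lborel_pair.Fubini') (simp add: split_beta')
  also have "\<dots> = (\<integral>\<^sup>+x. 2 * h x \<partial>lborel)"
  proof (intro nn_integral_cong)
    fix x
    have "(\<integral>\<^sup>+z. ?I (x \<bullet> b - z) * h x \<partial>lborel) = (\<integral>\<^sup>+z. indicator {x \<bullet> b - 1..x \<bullet> b + 1} z \<partial>lborel) * h x"
      by (subst nn_integral_multc[symmetric]) (auto intro!: nn_integral_cong simp: indicator_def)
    then show "(\<integral>\<^sup>+z. ?I (x \<bullet> b - z) * h x \<partial>lborel) = 2 * h x"
      by simp
  qed
  also have "\<dots> = 2 * (\<integral>\<^sup>+x. h x \<partial>lborel)"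
    by (simp add: nn_integral_cmult)
  finally show ?thesis .
qed

lemma measurable_bdry_weight_snd [measurable]:
  "(\<lambda>p::'a::euclidean_space \<times> real. bdry_weight k (snd p)) \<in> borel_measurable borel"
  by (rule measurable_compose[OF _ measurable_bdry_weight])
    (intro borel_measurable_continuous_onI continuous_intros)

lemma nn_integral_lborel_slices:
  fixes F :: "'a::euclidean_space \<times> real \<Rightarrow> ennreal"
  assumes [measurable]: "F \<in> borel_measurable borel"
  shows "(\<integral>\<^sup>+p. F p \<partial>lborel) = (\<integral>\<^sup>+l. (\<integral>\<^sup>+x. F (x, l) \<partial>lborel) \<partial>lborel)"
proof -
  have "(\<integral>\<^sup>+p. F p \<partial>lborel) = (\<integral>\<^sup>+p. F p \<partial>(lborel \<Otimes>\<^sub>M lborel))"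
    by (simp add: lborel_prod)
  also have "\<dots> = (\<integral>\<^sup>+l. (\<integral>\<^sup>+x. F (x, l) \<partial>lborel) \<partial>lborel)"
    by (rule lborel_pair.nn_integral_snd[symmetric]) (simp add: lborel_prod)
  finally show ?thesis .
qed

text \<open>A nonnegative \<open>C\<^sup>1\<close> function whose support is bounded and lies over the unit ball; \<open>D v\<close> is its
  derivative in direction \<open>v\<close>. It may be nonzero at the ends \<open>\<lambda> = \<plusminus>1\<close> of the
  finite cylinder.\<close>

locale cylinder_C1 =
  fixes w :: "'a::euclidean_space \<times> real \<Rightarrow> real"
    and D :: "'a \<times> real \<Rightarrow> 'a \<times> real \<Rightarrow> real"
    and S :: "('a \<times> real) set"
  assumes nonneg: "0 \<le> w p"
    and cont: "continuous_on UNIV w"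
    and cont_D: "continuous_on UNIV (D v)"
    and deriv: "((\<lambda>s. w (p + s *\<^sub>R v)) has_real_derivative D v p) (at 0)"
    and bounded_S: "bounded S"
    and support: "p \<notin> S \<Longrightarrow> w p = 0"
    and in_cylinder: "p \<in> S \<Longrightarrow> norm (fst p) < 1"
begin

lemma measurable_w [measurable]: "w \<in> borel_measurable borel"
  using cont by (rule borel_measurable_continuous_onI)

lemma measurable_D [measurable]: "D v \<in> borel_measurable borel"
  using cont_D by (rule borel_measurable_continuous_onI)

lemma deriv_line: "((\<lambda>s. w (p + s *\<^sub>R v)) has_real_derivative D v (p + s *\<^sub>R v)) (at s)"
proof -
  have "((\<lambda>r. w (p + (r + s) *\<^sub>R v)) has_real_derivative D v (p + s *\<^sub>R v)) (at 0)"
    using deriv[of "p + s *\<^sub>R v" v] by (simp add: algebra_simps)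
  then show ?thesis
    using DERIV_shift[of "\<lambda>s. w (p + s *\<^sub>R v)" "D v (p + s *\<^sub>R v)" 0 s] by simp
qed

lemma cont_D_line: "continuous_on UNIV (\<lambda>s. D v (p + s *\<^sub>R v))"
  by (rule continuous_on_compose2[OF cont_D]) (auto intro!: continuous_intros)

definition L :: "real \<Rightarrow> ennreal" where
  "L l = (\<integral>\<^sup>+x. ennreal (w (x, l)) \<partial>lborel)"

definition T :: "real \<Rightarrow> ennreal" where
  "T l = (\<integral>\<^sup>+x. ennreal \<bar>D (0, 1) (x, l)\<bar> \<partial>lborel)"

definition P :: "real \<Rightarrow> ennreal" where
  "P l = (\<Sum>b\<in>Basis. \<integral>\<^sup>+x. ennreal \<bar>D (b, 0) (x, l)\<bar> \<partial>lborel)"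

lemma measurable_LTP [measurable]:
  "L \<in> borel_measurable borel" "T \<in> borel_measurable borel" "P \<in> borel_measurable borel"
  unfolding L_def T_def P_def by measurable

lemma w_le_nn_integral_line:
  assumes "b \<noteq> 0"
  shows "ennreal (w (x, l)) \<le> (\<integral>\<^sup>+z. ennreal \<bar>D (b, 0) (x + z *\<^sub>R b, l)\<bar> \<partial>lborel)"
proof -
  obtain B where B: "\<And>p. p \<in> S \<Longrightarrow> norm p \<le> B"
    using bounded_S by (auto simp: bounded_iff)
  \<comment> \<open>Far enough back on the line to have left the support, which lies within distance \<open>B\<close> of the origin.\<close>
  define R where "R = (\<bar>B\<bar> + norm (x, l) + 1) / norm b"
  have R: "R * norm b = \<bar>B\<bar> + norm (x, l) + 1" "0 \<le> R"
    using assms by (simp_all add: R_def)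
  have "norm ((x, l) + (- R) *\<^sub>R (b, 0)) \<ge> norm ((-R) *\<^sub>R (b, 0 :: real)) - norm (x, l)"
    using norm_diff_ineq[of "(-R) *\<^sub>R (b, 0 :: real)" "(x, l)"] by (simp only: add.commute)
  moreover have "norm ((-R) *\<^sub>R (b, 0 :: real)) = R * norm b"
    using R by (simp only: norm_scaleR norm_Pair) simp
  ultimately have "(x, l) + (- R) *\<^sub>R (b, 0) \<notin> S"
    using B R by fastforce
  then have 0: "w ((x, l) + (- R) *\<^sub>R (b, 0)) = 0"
    by (rule support)
  have "ennreal \<bar>w ((x, l) + 0 *\<^sub>R (b, 0))\<bar> \<le> ennreal \<bar>w ((x, l) + (- R) *\<^sub>R (b, 0))\<bar>
      + (\<integral>\<^sup>+s. ennreal \<bar>D (b, 0) ((x, l) + s *\<^sub>R (b, 0))\<bar> * indicator {- R..0} s \<partial>lborel)"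
    using R by (intro abs_le_abs_plus_nn_integral_deriv(1) deriv_line cont_D_line) auto
  also have "\<dots> \<le> (\<integral>\<^sup>+s. ennreal \<bar>D (b, 0) ((x, l) + s *\<^sub>R (b, 0))\<bar> \<partial>lborel)"
    unfolding 0 by (auto intro!: nn_integral_mono simp: indicator_def)
  finally show ?thesis
    using nonneg by simp
qed

lemma L_le_P: "L l \<le> 2 * P l"
proof -
  obtain b :: 'a where b: "b \<in> Basis"
    using nonempty_Basis by blast
  have "L l \<le> 2 * (\<integral>\<^sup>+x. ennreal \<bar>D (b, 0) (x, l)\<bar> \<partial>lborel)"
    unfolding L_def
  proof (rule Poincare_strip[OF _ _ b])
    fix x :: 'a assume "\<bar>x \<bullet> b\<bar> > 1"
    then have "(x, l) \<notin> S"
      using in_cylinder[of "(x, l)"] Basis_le_norm[OF b, of x] by auto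
    then show "ennreal (w (x, l)) = 0"
      by (simp add: support)
  next
    fix x show "ennreal (w (x, l)) \<le> (\<integral>\<^sup>+z. ennreal \<bar>D (b, 0) (x + z *\<^sub>R b, l)\<bar> \<partial>lborel)"
      using b by (intro w_le_nn_integral_line) auto
  qed auto
  also have "(\<integral>\<^sup>+x. ennreal \<bar>D (b, 0) (x, l)\<bar> \<partial>lborel) \<le> P l"
    unfolding P_def by (rule member_le_sum[OF b]) auto
  finally show ?thesis
    by (simp add: mult_left_mono)
qed

lemma slice_gagliardo_nirenberg:
  "(\<integral>\<^sup>+x. ennreal_powr (ennreal (w (x, l))) (1 + 1 / DIM('a)) \<partial>lborel)
    \<le> P l * ennreal_powr (L l) (1 / DIM('a))"
  unfolding P_def L_def
  by (intro gagliardo_nirenberg_lborel w_le_nn_integral_line) auto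

text \<open>Integrate \<open>\<partial>\<^sub>\<lambda> w\<close> along the axis for each \<open>x'\<close>. Using the symmetric interval \<open>\<bar>m\<bar> \<le> \<bar>l\<bar>\<close> instead of the
  one between \<open>0\<close> and \<open>l\<close> treats both ends of the cylinder at once.\<close>

lemma slice_difference:
  "L l \<le> L 0 + (\<integral>\<^sup>+m. T m * indicator {m. \<bar>m\<bar> \<le> \<bar>l\<bar>} m \<partial>lborel)"
  "L 0 \<le> L l + (\<integral>\<^sup>+m. T m * indicator {m. \<bar>m\<bar> \<le> \<bar>l\<bar>} m \<partial>lborel)"
proof -
  let ?J = "\<lambda>x. \<integral>\<^sup>+m. ennreal \<bar>D (0, 1) (x, m)\<bar> * indicator {m. \<bar>m\<bar> \<le> \<bar>l\<bar>} m \<partial>lborel"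
  have [measurable]: "{m. \<bar>m\<bar> \<le> \<bar>l\<bar>} \<in> sets borel"
    by measurable
  have J [measurable]: "?J \<in> borel_measurable borel"
    by measurable
  have swap: "(\<integral>\<^sup>+x. ?J x \<partial>lborel) = (\<integral>\<^sup>+m. T m * indicator {m. \<bar>m\<bar> \<le> \<bar>l\<bar>} m \<partial>lborel)"
    unfolding T_def
    by (subst lborel_pair.Fubini') (auto simp: nn_integral_multc)
  have both: "ennreal (w (x, l)) \<le> ennreal (w (x, 0)) + ?J x \<and> ennreal (w (x, 0)) \<le> ennreal (w (x, l)) + ?J x" for x
  proof -
    \<comment> \<open>The end points are ordered so that one application of the fundamental theorem covers both signs of \<open>l\<close>.\<close>
    define c d where "c = min 0 l" and "d = max 0 l"
    have cd: "c \<le> d"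
      by (simp add: c_def d_def)
    have sub: "(\<integral>\<^sup>+s. ennreal \<bar>D (0, 1) ((x, 0) + s *\<^sub>R (0, 1))\<bar> * indicator {c..d} s \<partial>lborel) \<le> ?J x"
      by (intro nn_integral_mono) (auto simp: indicator_def c_def d_def)
    have "ennreal \<bar>w ((x, 0) + d *\<^sub>R (0, 1))\<bar> \<le> ennreal \<bar>w ((x, 0) + c *\<^sub>R (0, 1))\<bar> + ?J x"
      using abs_le_abs_plus_nn_integral_deriv(1)[OF deriv_line cont_D_line cd, of "(x, 0)" "(0, 1)"] sub
      by (meson add_left_mono order_trans)
    moreover have "ennreal \<bar>w ((x, 0) + c *\<^sub>R (0, 1))\<bar> \<le> ennreal \<bar>w ((x, 0) + d *\<^sub>R (0, 1))\<bar> + ?J x"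
      using abs_le_abs_plus_nn_integral_deriv(2)[OF deriv_line cont_D_line cd, of "(x, 0)" "(0, 1)"] sub
      by (meson add_left_mono order_trans)
    ultimately show ?thesis
      using nonneg by (cases "0 \<le> l") (auto simp: c_def d_def)
  qed
  have "L l \<le> (\<integral>\<^sup>+x. ennreal (w (x, 0)) + ?J x \<partial>lborel)"
    unfolding L_def using both by (intro nn_integral_mono) auto
  also have "\<dots> = L 0 + (\<integral>\<^sup>+x. ?J x \<partial>lborel)"
    unfolding L_def by (intro nn_integral_add) auto
  finally show "L l \<le> L 0 + (\<integral>\<^sup>+m. T m * indicator {m. \<bar>m\<bar> \<le> \<bar>l\<bar>} m \<partial>lborel)"
    unfolding swap .
  have "L 0 \<le> (\<integral>\<^sup>+x. ennreal (w (x, l)) + ?J x \<partial>lborel)"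
    unfolding L_def using both by (intro nn_integral_mono) auto
  also have "\<dots> = L l + (\<integral>\<^sup>+x. ?J x \<partial>lborel)"
    unfolding L_def by (intro nn_integral_add) auto
  finally show "L 0 \<le> L l + (\<integral>\<^sup>+m. T m * indicator {m. \<bar>m\<bar> \<le> \<bar>l\<bar>} m \<partial>lborel)"
    unfolding swap .
qed

definition K :: "real \<Rightarrow> real \<Rightarrow> ennreal" where
  "K a b = (\<integral>\<^sup>+p. bdry_weight a (snd p) * (\<Sum>v\<in>Basis. ennreal \<bar>D (v, 0) p\<bar>)
      + bdry_weight b (snd p) * ennreal \<bar>D (0, 1) p\<bar> \<partial>lborel)"

lemma K_eq: "K a b = (\<integral>\<^sup>+l. bdry_weight a l * P l \<partial>lborel) + (\<integral>\<^sup>+l. bdry_weight b l * T l \<partial>lborel)"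
proof -
  have "K a b = (\<integral>\<^sup>+l. (\<integral>\<^sup>+x. bdry_weight a l * (\<Sum>v\<in>Basis. ennreal \<bar>D (v, 0) (x, l)\<bar>)
      + bdry_weight b l * ennreal \<bar>D (0, 1) (x, l)\<bar> \<partial>lborel) \<partial>lborel)"
    unfolding K_def by (subst nn_integral_lborel_slices) auto
  also have "\<dots> = (\<integral>\<^sup>+l. bdry_weight a l * P l + bdry_weight b l * T l \<partial>lborel)"
    unfolding P_def T_def
    by (intro nn_integral_cong) (simp add: nn_integral_add nn_integral_cmult nn_integral_sum del: sum_ennreal)
  finally show ?thesis
    by (simp add: nn_integral_add)
qed

lemma weighted_Poincare:
  "(\<integral>\<^sup>+p. bdry_weight a (snd p) * ennreal (w p) \<partial>lborel) \<le> 2 * K a b"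
proof -
  have "(\<integral>\<^sup>+p. bdry_weight a (snd p) * ennreal (w p) \<partial>lborel) = (\<integral>\<^sup>+l. bdry_weight a l * L l \<partial>lborel)"
    unfolding L_def by (subst nn_integral_lborel_slices) (auto simp: nn_integral_cmult)
  also have "\<dots> \<le> (\<integral>\<^sup>+l. 2 * (bdry_weight a l * P l) \<partial>lborel)"
  proof (intro nn_integral_mono)
    fix l
    have "bdry_weight a l * L l \<le> bdry_weight a l * (2 * P l)"
      by (intro mult_left_mono L_le_P) simp
    then show "bdry_weight a l * L l \<le> 2 * (bdry_weight a l * P l)"
      by (simp add: mult_ac)
  qed
  also have "\<dots> \<le> 2 * K a b"
    unfolding K_eq by (subst nn_integral_cmult) (auto intro!: mult_left_mono)
  finally show ?thesis .
qed

text \<open>The exponent \<open>e\<close> is tied to the weights by \<open>scaling\<close>, the relation that makes both sides scale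
  alike near the ends of the cylinder. With \<open>t = m e\<close> for the slice dimension \<open>m\<close>, Hoelder interpolates
  \<open>\<integral>w\<^sup>1\<^sup>+\<^sup>e\<close> on a slice between \<open>L\<close> and the slice inequality, leaving \<open>L\<^sup>1\<^sup>-\<^sup>t\<^sup>+\<^sup>e P\<^sup>t\<close>, which the interpolation
  lemma for slices then integrates over \<open>\<lambda>\<close>. The constant \<open>2a + 5\<close> collects \<open>2(a + 1) + 2\<close> from the middle
  slice, where Poincare costs the factor \<open>2\<close>, and \<open>1\<close> from the derivative term; \<open>2 / b\<close> is the Hardy constant.\<close>

lemma weighted_gagliardo_nirenberg:
  fixes a b e :: real
  assumes a: "-1 < a" and b: "0 < b" "b \<le> a + 1"
    and e: "0 < e" "DIM('a) * e < 1"
    and scaling: "a * (1 - DIM('a) * e) = b * e + (b - 1) * (1 - DIM('a) * e)"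
  shows "(\<integral>\<^sup>+p. bdry_weight a (snd p) * ennreal_powr (ennreal (w p)) (1 + e) \<partial>lborel)
    \<le> ennreal_powr (ennreal ((2 * a + 5) * (1 + 2 / b)) * K a b) (1 + e)"
proof -
  define m where "m = real DIM('a)"
  define t where "t = m * e"
  have m: "m \<ge> 1"
    by (simp add: m_def Suc_leI)
  have t: "0 < t" "t < 1"
    using e m by (auto simp: t_def m_def)
  define C where "C = ennreal ((2 * a + 5) * (1 + 2 / b)) * K a b"
  have T: "(\<integral>\<^sup>+l. bdry_weight b l * T l \<partial>lborel) \<le> K a b"
    and P: "(\<integral>\<^sup>+l. bdry_weight a l * P l \<partial>lborel) \<le> K a b"
    by (simp_all add: K_eq)
  have WL: "(\<integral>\<^sup>+l. bdry_weight a l * L l \<partial>lborel) \<le> 2 * K a b"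
    using weighted_Poincare[of a b] unfolding L_def
    by (subst (asm) nn_integral_lborel_slices) (auto simp: nn_integral_cmult)
  have "L 0 \<le> ennreal (a + 1) * (\<integral>\<^sup>+l. bdry_weight a l * L l \<partial>lborel)
      + 2 * (\<integral>\<^sup>+l. bdry_weight b l * T l \<partial>lborel)"
    using a b by (intro weighted_trace_bound slice_difference) auto
  also have "\<dots> \<le> ennreal (a + 1) * (2 * K a b) + 2 * K a b"
    using WL T by (intro add_mono mult_left_mono) auto
  finally have "L 0 + (\<integral>\<^sup>+l. bdry_weight b l * T l \<partial>lborel) \<le> ennreal (a + 1) * (2 * K a b) + 2 * K a b + K a b"
    using T by (rule add_mono)
  also have "\<dots> = (ennreal (a + 1) * 2 + 2 + 1) * K a b"
    by (simp add: distrib_right mult.assoc)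
  also have "ennreal (a + 1) * 2 + 2 + 1 = ennreal ((a + 1) * 2 + 2 + 1)"
  proof -
    have *: "ennreal c * 2 + 2 + 1 = ennreal (c * 2 + 2 + 1)" if "0 \<le> c" for c
      using that by (subst ennreal_plus; simp add: ennreal_mult)+
    show ?thesis
      by (rule *) (use a in simp)
  qed
  finally have base: "L 0 + (\<integral>\<^sup>+l. bdry_weight b l * T l \<partial>lborel) \<le> ennreal (2 * a + 5) * K a b"
    by (simp add: algebra_simps)
  have c1: "ennreal (2 * a + 5) * K a b \<le> C"
    and c2: "ennreal (2 / b) * (ennreal (2 * a + 5) * K a b) \<le> C" and c3: "K a b \<le> C"
  proof -
    have "x \<le> x * (1 + y)" "y * x \<le> x * (1 + y)" "1 \<le> x * (1 + y)" if "1 \<le> x" "0 \<le> y" for x y :: real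
      using that mult_nonneg_nonneg[of x y] unfolding distrib_left mult_1_right mult.commute[of y x]
      by linarith+
    from this[of "2 * a + 5" "2 / b"]
    have *: "2 * a + 5 \<le> (2 * a + 5) * (1 + 2 / b)" "(2 / b) * (2 * a + 5) \<le> (2 * a + 5) * (1 + 2 / b)"
      "1 \<le> (2 * a + 5) * (1 + 2 / b)"
      using a b by simp_all
    show "ennreal (2 * a + 5) * K a b \<le> C"
      unfolding C_def by (intro mult_right_mono ennreal_leI *) auto
    have "ennreal (2 / b) * (ennreal (2 * a + 5) * K a b) = ennreal ((2 / b) * (2 * a + 5)) * K a b"
      using a b by (subst ennreal_mult) (auto simp: mult.assoc)
    then show "ennreal (2 / b) * (ennreal (2 * a + 5) * K a b) \<le> C"
      unfolding C_def using * by (auto intro!: mult_right_mono ennreal_leI simp del: times_divide_eq_left)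
    have "1 * K a b \<le> C"
      unfolding C_def using * by (intro mult_right_mono) auto
    then show "K a b \<le> C" by simp
  qed
  have sup: "bdry_weight b l * L l \<le> C" if "\<bar>l\<bar> < 1" for l
  proof -
    have "bdry_weight b l * L l \<le> L 0 + (\<integral>\<^sup>+m. bdry_weight b m * T m \<partial>lborel)"
      using b that by (intro weighted_sup_bound slice_difference) auto
    then show ?thesis
      using base c1 by (meson order_trans)
  qed
  have "(\<integral>\<^sup>+l. bdry_weight (b - 1) l * L l \<partial>lborel)
    \<le> ennreal (2 / b) * (L 0 + (\<integral>\<^sup>+m. bdry_weight b m * T m \<partial>lborel))"
    using b by (intro weighted_Hardy_bound slice_difference) auto
  also have "\<dots> \<le> ennreal (2 / b) * (ennreal (2 * a + 5) * K a b)"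
    by (intro mult_left_mono base) auto
  also note c2
  finally have hardy: "(\<integral>\<^sup>+l. bdry_weight (b - 1) l * L l \<partial>lborel) \<le> C" .
  have slice: "(\<integral>\<^sup>+x. ennreal_powr (ennreal (w (x, l))) (1 + e) \<partial>lborel)
    \<le> ennreal_powr (L l) (1 - t + e) * ennreal_powr (P l) t" for l
  proof -
    let ?w = "\<lambda>x. ennreal (w (x, l))"
    \<comment> \<open>Interpolation of \<open>1 + e\<close> between \<open>1 + 1/m\<close> and \<open>1\<close>.\<close>
    have exps: "1 + e = (1 + 1 / m) * t + (1 - t)" and te: "1 / m * t = e"
      using m by (simp_all add: t_def field_simps)
    have "(\<integral>\<^sup>+x. ennreal_powr (?w x) (1 + e) \<partial>lborel)
      = (\<integral>\<^sup>+x. ennreal_powr (ennreal_powr (?w x) (1 + 1 / m)) t * ennreal_powr (?w x) (1 - t) \<partial>lborel)"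
      by (simp only: exps ennreal_powr_powr ennreal_powr_add[of _ "(1 + 1 / m) * t" "1 - t"])
    also have "\<dots> \<le> ennreal_powr (\<integral>\<^sup>+x. ennreal_powr (?w x) (1 + 1 / m) \<partial>lborel) t * ennreal_powr (L l) (1 - t)"
      unfolding L_def using t by (intro nn_integral_Holder) auto
    also have "\<dots> \<le> ennreal_powr (P l * ennreal_powr (L l) (1 / m)) t * ennreal_powr (L l) (1 - t)"
      using t slice_gagliardo_nirenberg[of l] by (intro mult_right_mono ennreal_powr_mono) (auto simp: m_def)
    also have "\<dots> = ennreal_powr (L l) (1 - t + e) * ennreal_powr (P l) t"
      unfolding ennreal_powr_mult ennreal_powr_powr te by (simp only: ennreal_powr_add mult_ac)
    finally show ?thesis .
  qed
  have "(\<integral>\<^sup>+p. bdry_weight a (snd p) * ennreal_powr (ennreal (w p)) (1 + e) \<partial>lborel)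
    = (\<integral>\<^sup>+l. bdry_weight a l * (\<integral>\<^sup>+x. ennreal_powr (ennreal (w (x, l))) (1 + e) \<partial>lborel) \<partial>lborel)"
    by (subst nn_integral_lborel_slices) (auto simp: nn_integral_cmult)
  also have "\<dots> \<le> (\<integral>\<^sup>+l. bdry_weight a l * (ennreal_powr (L l) (1 - t + e) * ennreal_powr (P l) t) \<partial>lborel)"
    by (intro nn_integral_mono mult_left_mono slice) auto
  also have "\<dots> \<le> ennreal_powr C (1 + e)"
    using t e scaling sup hardy P c3
    by (intro nn_integral_slice_interpolation[where b=b]) (auto simp: t_def m_def)
  finally show ?thesis
    unfolding C_def .
qed

end

section \<open>From first order to the energy\<close>

lemma continuous_on_signed_powr:
  fixes k :: real
  assumes "0 < k"
  shows "continuous_on UNIV (\<lambda>y::real. \<bar>y\<bar> powr k * sgn y)"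
proof -
  have eq: "(\<lambda>y::real. \<bar>y\<bar> powr k * sgn y) = (\<lambda>y. max y 0 powr k - max (- y) 0 powr k)"
    by (auto simp: sgn_if max_def fun_eq_iff)
  show ?thesis
    unfolding eq using assms by (intro continuous_intros continuous_on_powr') auto
qed

text \<open>The point of the condition \<open>1 < k\<close> is \<open>x = 0\<close>, where the difference quotient is \<open>\<bar>h\<bar>\<^sup>k\<^sup>-\<^sup>1\<close> up to sign.\<close>

lemma has_real_derivative_abs_powr:
  fixes k x :: real
  assumes k: "1 < k"
  shows "((\<lambda>y. \<bar>y\<bar> powr k) has_real_derivative k * (\<bar>x\<bar> powr (k - 1) * sgn x)) (at x)"
proof (cases "x = 0")
  case True
  have "isCont (\<lambda>y::real. \<bar>y\<bar> powr (k - 1) * sgn y) 0"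
    using continuous_on_signed_powr[of "k - 1"] k by (simp add: continuous_on_eq_continuous_at)
  then have "((\<lambda>y::real. \<bar>y\<bar> powr (k - 1) * sgn y) \<longlongrightarrow> 0) (at 0)"
    by (simp add: isCont_def)
  moreover have "eventually (\<lambda>h::real. \<bar>h\<bar> powr (k - 1) * sgn h = (\<bar>0 + h\<bar> powr k - \<bar>0\<bar> powr k) / h) (at 0)"
  proof -
    have "\<bar>h\<bar> powr (k - 1) * sgn h = \<bar>h\<bar> powr k / h" if "h \<noteq> 0" for h :: real
      using that by (auto simp: powr_diff sgn_if)
    then show ?thesis
      by (auto simp: eventually_at_filter)
  qed
  ultimately have "((\<lambda>h::real. (\<bar>0 + h\<bar> powr k - \<bar>0\<bar> powr k) / h) \<longlongrightarrow> 0) (at 0)"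
    by (rule Lim_transform_eventually)
  then show ?thesis
    using True by (simp add: DERIV_def)
next
  case False
  then consider "x > 0" | "x < 0" by linarith
  then show ?thesis
  proof cases
    case 1
    have "((\<lambda>y. y powr k) has_real_derivative k * (\<bar>x\<bar> powr (k - 1) * sgn x)) (at x)"
      using 1 by (auto intro!: derivative_eq_intros)
    moreover have ev: "eventually (\<lambda>y. y powr k = \<bar>y\<bar> powr k) (nhds x)"
      using eventually_nhds_in_open[of "{0<..}" x] 1 by (auto elim: eventually_mono)
    ultimately show ?thesis
      unfolding DERIV_cong_ev[OF refl ev refl] by blast
  next
    case 2
    have "((\<lambda>y. (- y) powr k) has_real_derivative k * (\<bar>x\<bar> powr (k - 1) * sgn x)) (at x)"
      using 2 by (auto intro!: derivative_eq_intros)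
    moreover have ev: "eventually (\<lambda>y. (- y) powr k = \<bar>y\<bar> powr k) (nhds x)"
      using eventually_nhds_in_open[of "{..<0}" x] 2 by (auto elim: eventually_mono)
    ultimately show ?thesis
      unfolding DERIV_cong_ev[OF refl ev refl] by blast
  qed
qed

lemma Cc_infty_differentiable: "f \<in> Cc_infty U \<Longrightarrow> f differentiable (at p)"
proof -
  assume "f \<in> Cc_infty U"
  then have "Ck (Suc 0) f" unfolding Cc_infty_def by blast
  then show ?thesis by simp
qed

lemma Cc_infty_continuous_derivative:
  "f \<in> Cc_infty U \<Longrightarrow> continuous_on UNIV (\<lambda>p. frechet_derivative f (at p) v)"
proof -
  assume "f \<in> Cc_infty U"
  then have "Ck (Suc 0) f" unfolding Cc_infty_def by blast
  then show ?thesis by simp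
qed

lemma Cc_infty_continuous: "f \<in> Cc_infty U \<Longrightarrow> continuous_on UNIV f"
proof -
  assume "f \<in> Cc_infty U"
  then have "Ck 0 f" unfolding Cc_infty_def by blast
  then show ?thesis by simp
qed

lemma differentiable_directional_derivative:
  assumes "f differentiable (at p)"
  shows "((\<lambda>s. f (p + s *\<^sub>R v)) has_real_derivative frechet_derivative f (at p) v) (at 0)"
proof -
  have f: "(f has_derivative frechet_derivative f (at p)) (at p)"
    using assms by (simp add: frechet_derivative_works)
  have "((\<lambda>s. p + s *\<^sub>R v) has_derivative (\<lambda>s. s *\<^sub>R v)) (at 0)"
    by (auto intro!: derivative_eq_intros)
  from has_derivative_compose[OF this, of f "frechet_derivative f (at p)"] f
  have "((\<lambda>s. f (p + s *\<^sub>R v)) has_derivative (\<lambda>s. frechet_derivative f (at p) (s *\<^sub>R v))) (at 0)"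
    by simp
  moreover have "linear (frechet_derivative f (at p))"
    using f by (rule has_derivative_linear)
  then have "(\<lambda>s. frechet_derivative f (at p) (s *\<^sub>R v)) = (*) (frechet_derivative f (at p) v)"
    by (simp add: linear_cmul fun_eq_iff)
  ultimately show ?thesis
    by (simp only: has_field_derivative_def)
qed

lemma Cc_infty_vanishes_outside:
  assumes "f \<in> Cc_infty (inf_cyl :: ((real ^ 'n) \<times> real) set)" "\<not> norm (fst p) < 1"
  shows "f p = 0"
proof (rule ccontr)
  assume "f p \<noteq> 0"
  then have "p \<in> closure {x. f x \<noteq> 0}"
    by (intro closure_subset[THEN subsetD]) simp
  then have "p \<in> inf_cyl"
    using assms(1) by (auto simp: Cc_infty_def)
  then show False
    using assms(2) by (auto simp: inf_cyl_def)
qed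

lemma cylinder_C1_abs_powr:
  assumes f: "f \<in> Cc_infty (inf_cyl :: ((real ^ 'n) \<times> real) set)" and k: "1 < k"
  shows "cylinder_C1 (\<lambda>p. \<bar>f p\<bar> powr k)
    (\<lambda>v p. k * (\<bar>f p\<bar> powr (k - 1) * sgn (f p)) * frechet_derivative f (at p) v)
    (closure {x. f x \<noteq> 0})"
proof
  fix p v :: "(real ^ 'n) \<times> real"
  show "0 \<le> \<bar>f p\<bar> powr k" by simp
  show "continuous_on UNIV (\<lambda>p. \<bar>f p\<bar> powr k)"
    using k by (intro continuous_on_powr' continuous_intros Cc_infty_continuous[OF f]) auto
  show "continuous_on UNIV (\<lambda>p. k * (\<bar>f p\<bar> powr (k - 1) * sgn (f p)) * frechet_derivative f (at p) v)"
    using k by (intro continuous_intros Cc_infty_continuous_derivative[OF f]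
      continuous_on_compose2[OF continuous_on_signed_powr Cc_infty_continuous[OF f]]) auto
  have "((\<lambda>s. f (p + s *\<^sub>R v)) has_real_derivative frechet_derivative f (at p) v) (at 0)"
    by (intro differentiable_directional_derivative Cc_infty_differentiable[OF f])
  from DERIV_chain2[OF _ this, of "\<lambda>y. \<bar>y\<bar> powr k"] has_real_derivative_abs_powr[OF k, of "f p"]
  show "((\<lambda>s. \<bar>f (p + s *\<^sub>R v)\<bar> powr k) has_real_derivative
      k * (\<bar>f p\<bar> powr (k - 1) * sgn (f p)) * frechet_derivative f (at p) v) (at 0)"
    by simp
  show "bounded (closure {x. f x \<noteq> 0})"
    using f by (auto simp: Cc_infty_def compact_imp_bounded)
  show "p \<notin> closure {x. f x \<noteq> 0} \<Longrightarrow> \<bar>f p\<bar> powr k = 0"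
    using closure_subset[of "{x. f x \<noteq> 0}"] by auto
  show "p \<in> closure {x. f x \<noteq> 0} \<Longrightarrow> norm (fst p) < 1"
    using f by (auto simp: Cc_infty_def inf_cyl_def)
qed

lemma mem_fin_cyl_iff: "p \<in> fin_cyl \<longleftrightarrow> norm (fst p) < 1 \<and> \<bar>snd p\<bar> < 1"
  by (cases p) (simp add: fin_cyl_def)

lemma weighted_power_integral_eq:
  assumes f: "f \<in> Cc_infty (inf_cyl :: ((real ^ 'n) \<times> real) set)"
  shows "weighted_power_integral a Q f = (\<integral>\<^sup>+p. bdry_weight a (snd p) * ennreal (\<bar>f p\<bar> powr Q) \<partial>lborel)"
  unfolding weighted_power_integral_def
proof (intro nn_integral_cong)
  fix p :: "(real ^ 'n) \<times> real"
  show "ennreal ((1 - \<bar>snd p\<bar>) powr a * \<bar>f p\<bar> powr Q) * indicator fin_cyl p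
    = bdry_weight a (snd p) * ennreal (\<bar>f p\<bar> powr Q)"
    using Cc_infty_vanishes_outside[OF f, of p]
    by (cases "norm (fst p) < 1"; cases "\<bar>snd p\<bar> < 1")
      (auto simp: bdry_weight_inside bdry_weight_outside mem_fin_cyl_iff indicator_def ennreal_mult)
qed

lemma borel_fin_cyl [measurable]: "(fin_cyl :: ((real ^ 'n) \<times> real) set) \<in> sets borel"
proof -
  have "fin_cyl = {p :: (real ^ 'n) \<times> real. norm (fst p) < 1} \<inter> {p. \<bar>snd p\<bar> < 1}"
    by (auto simp: mem_fin_cyl_iff)
  moreover have "open \<dots>"
    by (intro open_Int open_Collect_less continuous_intros)
  ultimately show ?thesis
    by simp
qed

lemma measurable_snd_borel [measurable]:
  "(snd :: 'a::euclidean_space \<times> real \<Rightarrow> real) \<in> borel_measurable borel"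
  by (intro borel_measurable_continuous_onI continuous_intros)

lemma weighted_cylinder_mass_finite:
  assumes a: "-1 < a"
  shows "(\<integral>\<^sup>+p\<in>(fin_cyl :: ((real ^ 'n) \<times> real) set). ennreal ((1 - \<bar>snd p\<bar>) powr a) \<partial>lborel) < \<infinity>"
proof -
  have "(\<integral>\<^sup>+p\<in>(fin_cyl :: ((real ^ 'n) \<times> real) set). ennreal ((1 - \<bar>snd p\<bar>) powr a) \<partial>lborel)
      = (\<integral>\<^sup>+p. indicator (ball 0 1) (fst p :: real ^ 'n) * bdry_weight a (snd p) \<partial>(lborel \<Otimes>\<^sub>M lborel))"
    unfolding lborel_prod
    by (intro nn_integral_cong) (auto simp: bdry_weight_def mem_fin_cyl_iff indicator_def)
  also have "\<dots> = (\<integral>\<^sup>+l. (\<integral>\<^sup>+x. indicator (ball 0 1) (x :: real ^ 'n) * bdry_weight a l \<partial>lborel) \<partial>lborel)"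
    by (subst lborel_pair.nn_integral_snd[symmetric])
      (auto intro!: borel_measurable_times_ennreal borel_measurable_indicator measurable_compose[OF measurable_fst]
        measurable_compose[OF measurable_snd])
  also have "\<dots> = emeasure lborel (ball (0 :: real ^ 'n) 1) * (\<integral>\<^sup>+l. bdry_weight a l \<partial>lborel)"
  proof -
    have "(\<integral>\<^sup>+x. indicator (ball 0 1) (x :: real ^ 'n) * c \<partial>lborel)
        = emeasure lborel (ball (0 :: real ^ 'n) 1) * c" for c :: ennreal
      by (subst nn_integral_multc) (auto intro!: borel_measurable_indicator)
    then show ?thesis
      by (simp add: nn_integral_cmult)
  qed
  also have "\<dots> < \<infinity>"
  proof -
    have "(\<integral>\<^sup>+l. bdry_weight a l \<partial>lborel) < \<infinity>"
      using bdry_weight_mass_le[of "a + 1"] a by (simp add: le_less_trans)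
    then show ?thesis
      by (simp add: ennreal_mult_less_top emeasure_lborel_ball_finite[simplified])
  qed
  finally show ?thesis .
qed

lemma weighted_power_integral_finite:
  assumes f: "f \<in> Cc_infty (inf_cyl :: ((real ^ 'n) \<times> real) set)" and a: "-1 < a" and Q: "0 \<le> Q"
  shows "weighted_power_integral a Q f < \<infinity>"
proof -
  have "compact (closure {x. f x \<noteq> 0})"
    using f by (simp add: Cc_infty_def)
  then have "bounded (f ` closure {x. f x \<noteq> 0})"
    using continuous_on_subset[OF Cc_infty_continuous[OF f]]
    by (intro compact_imp_bounded compact_continuous_image) auto
  then obtain B where B: "\<And>x. x \<in> closure {x. f x \<noteq> 0} \<Longrightarrow> \<bar>f x\<bar> \<le> B"
    by (auto simp: bounded_iff)
  have B': "\<bar>f x\<bar> \<le> \<bar>B\<bar>" for x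
    using B[of x] closure_subset[of "{x. f x \<noteq> 0}"] by (cases "f x = 0") auto
  have "weighted_power_integral a Q f
    \<le> (\<integral>\<^sup>+p. ennreal (\<bar>B\<bar> powr Q)
        * (ennreal ((1 - \<bar>snd p\<bar>) powr a) * indicator (fin_cyl :: ((real ^ 'n) \<times> real) set) p) \<partial>lborel)"
    unfolding weighted_power_integral_def
    using B' Q by (intro nn_integral_mono)
      (auto simp: indicator_def mult.commute simp flip: ennreal_mult intro!: ennreal_leI mult_right_mono powr_mono2)
  also have "\<dots> = ennreal (\<bar>B\<bar> powr Q) * (\<integral>\<^sup>+p\<in>(fin_cyl :: ((real ^ 'n) \<times> real) set). ennreal ((1 - \<bar>snd p\<bar>) powr a) \<partial>lborel)"
    by (intro nn_integral_cmult) measurable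
  also have "\<dots> < \<infinity>"
    using weighted_cylinder_mass_finite[OF a, where 'n='n] by (simp add: ennreal_mult_less_top)
  finally show ?thesis .
qed

lemma abs_partial_le_norm_grad:
  assumes "v \<in> (Basis :: (real ^ 'n) set)"
  shows "\<bar>frechet_derivative f (at p) (v, 0)\<bar> \<le> norm (grad_x' f p)"
proof -
  obtain i where "v = axis i 1"
    using assms by (auto simp: Basis_vec_def)
  then have "frechet_derivative f (at p) (v, 0) = grad_x' f p $ i"
    by (simp add: grad_x'_def)
  then show ?thesis
    using component_le_norm_cart[of "grad_x' f p" i] by simp
qed

lemma square_sum_le:
  fixes s m g r d :: real
  assumes "0 \<le> s" "s \<le> m * g" "1 \<le> m"
  shows "(s + r * d)\<^sup>2 \<le> 2 * m\<^sup>2 * (g\<^sup>2 + r\<^sup>2 * d\<^sup>2)"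
proof -
  have "(s + r * d)\<^sup>2 \<le> 2 * (s\<^sup>2 + (r * d)\<^sup>2)"
    using sum_squares_bound[of s "r * d"] by (simp add: power2_sum)
  also have "s\<^sup>2 \<le> m\<^sup>2 * g\<^sup>2"
    using assms power_mono[of s "m * g" 2] by (simp add: power_mult_distrib)
  also have "(r * d)\<^sup>2 \<le> m\<^sup>2 * (r\<^sup>2 * d\<^sup>2)"
    using assms mult_right_mono[of 1 "m\<^sup>2" "(r * d)\<^sup>2"] by (simp add: power_mult_distrib one_le_power)
  finally show ?thesis
    by (simp add: algebra_simps)
qed

text \<open>The exponent \<open>2k - 2\<close> arises because \<open>\<bar>\<nabla>\<bar>f\<bar>\<^sup>k\<bar> = k \<bar>f\<bar>\<^sup>k\<^sup>-\<^sup>1 \<bar>\<nabla>f\<bar>\<close> and Cauchy-Schwarz squares the first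
  factor. The axial weight \<open>a + \<sigma>/2\<close> splits as \<open>a/2 + (a + \<sigma>)/2\<close>, which gives the weight of the
  energy. The factor \<open>CARD('n)\<close> comes from summing the absolute values of the partial derivatives.\<close>

lemma K_abs_powr_le:
  fixes f :: "(real ^ 'n) \<times> real \<Rightarrow> real"
  assumes f: "f \<in> Cc_infty inf_cyl" and k: "1 < k"
  shows "cylinder_C1.K (\<lambda>v p. k * (\<bar>f p\<bar> powr (k - 1) * sgn (f p)) * frechet_derivative f (at p) v) a (a + \<sigma> / 2)
    \<le> ennreal (k * sqrt 2 * CARD('n)) *
        (ennreal_powr (weighted_power_integral a (2 * k - 2) f) (1 / 2) * ennreal_powr (weighted_energy a \<sigma> f) (1 / 2))"
proof -
  interpret cylinder_C1 "\<lambda>p. \<bar>f p\<bar> powr k"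
    "\<lambda>v p. k * (\<bar>f p\<bar> powr (k - 1) * sgn (f p)) * frechet_derivative f (at p) v" "closure {x. f x \<noteq> 0}"
    by (rule cylinder_C1_abs_powr[OF f k])
  define m where "m = real CARD('n)"
  have m: "1 \<le> m"
    by (simp add: m_def Suc_leI)
  define c where "c = k * sqrt 2 * m"
  have c: "0 \<le> c"
    using k m by (simp add: c_def)
  define F where "F = (\<lambda>p. ennreal ((1 - \<bar>snd p\<bar>) powr a * \<bar>f p\<bar> powr (2 * k - 2)) * indicator fin_cyl p)"
  define G where "G = (\<lambda>p. ennreal ((1 - \<bar>snd p\<bar>) powr a * ((norm (grad_x' f p))\<^sup>2
      + (1 - \<bar>snd p\<bar>) powr \<sigma> * (d_lambda f p)\<^sup>2)) * indicator fin_cyl p)"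
  have [measurable]: "f \<in> borel_measurable borel"
    by (rule borel_measurable_continuous_onI[OF Cc_infty_continuous[OF f]])
  have [measurable]: "d_lambda f \<in> borel_measurable borel"
    unfolding d_lambda_def by (rule borel_measurable_continuous_onI[OF Cc_infty_continuous_derivative[OF f]])
  have [measurable]: "grad_x' f \<in> borel_measurable borel"
    unfolding grad_x'_def
    by (intro borel_measurable_continuous_onI continuous_on_vec_lambda Cc_infty_continuous_derivative[OF f])
  have [measurable]: "F \<in> borel_measurable lborel" "G \<in> borel_measurable lborel"
    unfolding F_def G_def by measurable
  have "K a (a + \<sigma> / 2) \<le> (\<integral>\<^sup>+p. ennreal c * (ennreal_powr (F p) (1 / 2) * ennreal_powr (G p) (1 - 1 / 2)) \<partial>lborel)"
    unfolding K_def
  proof (intro nn_integral_mono)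
    fix p :: "(real ^ 'n) \<times> real"
    let ?D = "\<lambda>v. k * (\<bar>f p\<bar> powr (k - 1) * sgn (f p)) * frechet_derivative f (at p) v"
    show "bdry_weight a (snd p) * (\<Sum>v\<in>Basis. ennreal \<bar>?D (v, 0)\<bar>)
        + bdry_weight (a + \<sigma> / 2) (snd p) * ennreal \<bar>?D (0, 1)\<bar>
        \<le> ennreal c * (ennreal_powr (F p) (1 / 2) * ennreal_powr (G p) (1 - 1 / 2))"
    proof (cases "f p = 0 \<or> \<not> \<bar>snd p\<bar> < 1")
      case True
      then show ?thesis
        by (auto simp: bdry_weight_outside)
    next
      case False
      then have l: "\<bar>snd p\<bar> < 1" and f0: "f p \<noteq> 0"
        by auto
      then have "p \<in> fin_cyl"
        using Cc_infty_vanishes_outside[OF f, of p] by (auto simp: mem_fin_cyl_iff)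
      define t where "t = 1 - \<bar>snd p\<bar>"
      have t: "0 < t" using l by (simp add: t_def)
      define u where "u = \<bar>f p\<bar> powr (k - 1)"
      define g where "g = norm (grad_x' f p)"
      define d where "d = \<bar>d_lambda f p\<bar>"
      define s where "s = (\<Sum>v\<in>Basis. \<bar>frechet_derivative f (at p) (v :: real ^ 'n, 0 :: real)\<bar>)"
      define r where "r = t powr (\<sigma> / 2)"
      have nn: "0 \<le> u" "0 \<le> g" "0 \<le> d" "0 \<le> s" "0 \<le> r" "0 < k"
        using k by (auto simp: u_def g_def d_def s_def r_def intro!: sum_nonneg)
      have r2: "t powr \<sigma> = r\<^sup>2" and u2: "\<bar>f p\<bar> powr (2 * k - 2) = u\<^sup>2"
        using t f0 by (simp_all add: r_def u_def power2_eq_square algebra_simps flip: powr_add)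
      have "s \<le> (\<Sum>v\<in>(Basis :: (real ^ 'n) set). g)"
        unfolding s_def g_def by (intro sum_mono abs_partial_le_norm_grad)
      then have "s \<le> m * g"
        by (simp add: m_def)
      then have sq: "(s + r * d)\<^sup>2 \<le> 2 * m\<^sup>2 * (g\<^sup>2 + r\<^sup>2 * d\<^sup>2)"
        using nn m by (intro square_sum_le) auto
      have "bdry_weight a (snd p) * (\<Sum>v\<in>Basis. ennreal \<bar>?D (v, 0)\<bar>)
          + bdry_weight (a + \<sigma> / 2) (snd p) * ennreal \<bar>?D (0, 1)\<bar>
          = ennreal (t powr a) * ennreal (\<Sum>v\<in>Basis. k * u * \<bar>frechet_derivative f (at p) (v, 0)\<bar>)
          + ennreal (t powr a * r) * ennreal (k * u * d)"
        using l f0 k by (simp add: bdry_weight_inside abs_mult abs_sgn_eq u_def d_def d_lambda_def r_def t_def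
            powr_add)
      also have "(\<Sum>v\<in>Basis. k * u * \<bar>frechet_derivative f (at p) (v :: real ^ 'n, 0 :: real)\<bar>) = k * u * s"
        unfolding s_def by (simp add: sum_distrib_left)
      also have "ennreal (t powr a) * ennreal (k * u * s) + ennreal (t powr a * r) * ennreal (k * u * d)
          = ennreal (t powr a * (k * u * (s + r * d)))"
        using nn t by (simp add: algebra_simps flip: ennreal_mult ennreal_plus)
      also have "\<dots> \<le> ennreal (c * sqrt ((t powr a * u\<^sup>2) * (t powr a * (g\<^sup>2 + r\<^sup>2 * d\<^sup>2))))"
      proof (rule ennreal_leI)
        have "s + r * d \<le> sqrt (2 * m\<^sup>2 * (g\<^sup>2 + r\<^sup>2 * d\<^sup>2))"
          using sq by (intro real_le_rsqrt)
        also have "\<dots> = sqrt 2 * m * sqrt (g\<^sup>2 + r\<^sup>2 * d\<^sup>2)"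
          using m by (simp add: real_sqrt_mult)
        finally have "t powr a * (k * u * (s + r * d))
            \<le> t powr a * (k * u * (sqrt 2 * m * sqrt (g\<^sup>2 + r\<^sup>2 * d\<^sup>2)))"
          using nn t by (intro mult_left_mono) auto
        also have "\<dots> = c * (sqrt ((t powr a)\<^sup>2) * sqrt (u\<^sup>2) * sqrt (g\<^sup>2 + r\<^sup>2 * d\<^sup>2))"
          using nn t by (simp add: c_def)
        also have "\<dots> = c * sqrt ((t powr a * u\<^sup>2) * (t powr a * (g\<^sup>2 + r\<^sup>2 * d\<^sup>2)))"
          unfolding real_sqrt_mult[symmetric] by (simp add: power2_eq_square mult_ac)
        finally show "t powr a * (k * u * (s + r * d))
            \<le> c * sqrt ((t powr a * u\<^sup>2) * (t powr a * (g\<^sup>2 + r\<^sup>2 * d\<^sup>2)))" .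
      qed
      also have "\<dots> = ennreal c * (ennreal_powr (ennreal (t powr a * u\<^sup>2)) (1 / 2)
            * ennreal_powr (ennreal (t powr a * (g\<^sup>2 + r\<^sup>2 * d\<^sup>2))) (1 - 1 / 2))"
        using c nn t by (simp add: real_sqrt_mult powr_half_sqrt flip: ennreal_mult)
      also have "\<dots> = ennreal c * (ennreal_powr (F p) (1 / 2) * ennreal_powr (G p) (1 - 1 / 2))"
        using \<open>p \<in> fin_cyl\<close> by (simp add: F_def G_def u2 g_def d_def r2 flip: t_def)
      finally show ?thesis .
    qed
  qed
  also have "\<dots> = ennreal c * (\<integral>\<^sup>+p. ennreal_powr (F p) (1 / 2) * ennreal_powr (G p) (1 - 1 / 2) \<partial>lborel)"
    by (intro nn_integral_cmult) measurable
  also have "\<dots> \<le> ennreal c * (ennreal_powr (\<integral>\<^sup>+p. F p \<partial>lborel) (1 / 2) * ennreal_powr (\<integral>\<^sup>+p. G p \<partial>lborel) (1 - 1 / 2))"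
    by (intro mult_left_mono nn_integral_Holder) auto
  finally show ?thesis
    by (simp add: F_def G_def weighted_power_integral_def weighted_energy_def c_def m_def)
qed

text \<open>Formally, divide by \<open>X\<^sup>q\<^sup>/\<^sup>2\<close> and raise to the power \<open>2/q\<close>. The finiteness of \<open>X\<close> is what makes the
  division legitimate.\<close>

lemma ennreal_self_absorption:
  assumes fin: "X \<noteq> top" and q: "0 < q" "q < 2" and c: "0 < c"
    and le: "X \<le> ennreal_powr (ennreal c * (ennreal_powr X (1 / 2) * ennreal_powr E (1 / 2))) q"
  shows "ennreal_powr X ((2 - q) / q) \<le> ennreal (c\<^sup>2) * E"
proof (cases "X = 0 \<or> E = top")
  case True
  then show ?thesis
    using c by (auto simp: ennreal_mult_top)
next
  case False
  with fin obtain x y where xy: "X = ennreal x" "E = ennreal y" "0 < x" "0 \<le> y"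
    by (metis ennreal_cases ennreal_0 order_le_less)
  have "x \<le> (c * (x powr (1 / 2) * y powr (1 / 2))) powr q"
    using le xy c by (simp flip: ennreal_mult)
  then have "x powr (2 / q) \<le> ((c * (x powr (1 / 2) * y powr (1 / 2))) powr q) powr (2 / q)"
    using xy q by (intro powr_mono2) auto
  also have "\<dots> = c\<^sup>2 * (x * y)"
    using xy q c by (simp add: powr_powr powr_mult)
  finally have "x powr (2 / q) / x \<le> c\<^sup>2 * y"
    using xy by (simp add: field_simps)
  moreover have "x powr (2 / q) / x = x powr ((2 - q) / q)"
    using xy q by (simp add: diff_divide_distrib powr_diff)
  ultimately show ?thesis
    using xy by (simp flip: ennreal_mult)
qed

text \<open>The self-absorption argument with \<open>k = 2\<close> and \<open>q = 1\<close>: the exponent \<open>2k - 2 = 2\<close> reproduces the left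
  side. The estimate comes from the transversal derivatives, which is why every \<open>\<sigma>\<close> is admitted.\<close>

lemma weighted_Poincare_inequality:
  assumes a: "-1 < a"
  shows "\<exists>C>0. \<forall>f \<in> Cc_infty (inf_cyl :: ((real ^ 'n) \<times> real) set). weighted_sobolev_ineq C 2 a \<sigma> f"
proof (intro exI conjI ballI)
  define c where "c = 2 * (2 * sqrt 2 * CARD('n))"
  have c: "0 < c" by (simp add: c_def)
  then show "0 < c\<^sup>2" by simp
  fix f :: "(real ^ 'n) \<times> real \<Rightarrow> real" assume f: "f \<in> Cc_infty inf_cyl"
  let ?X = "weighted_power_integral a 2 f" and ?E = "weighted_energy a \<sigma> f"
  let ?K = "cylinder_C1.K (\<lambda>v p. 2 * (\<bar>f p\<bar> powr (2 - 1) * sgn (f p)) * frechet_derivative f (at p) v) a (a + \<sigma> / 2)"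
  interpret cylinder_C1 "\<lambda>p. \<bar>f p\<bar> powr 2"
    "\<lambda>v p. 2 * (\<bar>f p\<bar> powr (2 - 1) * sgn (f p)) * frechet_derivative f (at p) v" "closure {x. f x \<noteq> 0}"
    by (rule cylinder_C1_abs_powr[OF f]) simp
  have "?X \<le> 2 * ?K"
    unfolding weighted_power_integral_eq[OF f] by (rule weighted_Poincare)
  also have "\<dots> \<le> 2 * (ennreal (2 * sqrt 2 * CARD('n)) * (ennreal_powr ?X (1 / 2) * ennreal_powr ?E (1 / 2)))"
    using K_abs_powr_le[OF f, of 2 a \<sigma>] by (intro mult_left_mono) auto
  also have "\<dots> = ennreal_powr (ennreal c * (ennreal_powr ?X (1 / 2) * ennreal_powr ?E (1 / 2))) 1"
    by (simp add: c_def ennreal_mult mult.assoc)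
  finally have "ennreal_powr ?X ((2 - 1) / 1) \<le> ennreal (c\<^sup>2) * ?E"
    using weighted_power_integral_finite[OF f a, of 2] c by (intro ennreal_self_absorption) auto
  then show "weighted_sobolev_ineq (c\<^sup>2) 2 a \<sigma> f"
    by (simp add: weighted_sobolev_ineq_def)
qed

text \<open>Here \<open>e = 1/(m + A)\<close> solves the scaling relation, and \<open>k = 2/(1 - e)\<close> makes the left exponent
  \<open>k (1 + e)\<close> of the first-order inequality equal to the exponent \<open>2k - 2\<close> produced by
  Cauchy-Schwarz; both then equal \<open>Q_cr\<close>. The hypothesis \<open>-2a < \<sigma>\<close> enters as \<open>0 < b\<close>, the
  convergence condition of the Hardy inequality.\<close>

lemma weighted_Sobolev_inequality_critical:
  fixes a \<sigma> :: real
  assumes a: "-1 < a" and \<sigma>: "- 2 * a < \<sigma>" "\<sigma> < 2" and N: "CARD('n) = N - 1" "2 \<le> N"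
  shows "\<exists>C>0. \<forall>f \<in> Cc_infty (inf_cyl :: ((real ^ 'n) \<times> real) set). weighted_sobolev_ineq C (Q_cr N a \<sigma>) a \<sigma> f"
proof (intro exI conjI ballI)
  define b where "b = a + \<sigma> / 2"
  define A where "A = (2 * a + \<sigma>) / (2 - \<sigma>)"
  define m where "m = real CARD('n)"
  define e where "e = 1 / (m + A)"
  define k where "k = 2 / (1 - e)"
  have m: "1 \<le> m" and mN: "real N = m + 1"
    using N by (simp_all add: m_def Suc_leI)
  have b: "0 < b" "b \<le> a + 1"
    using \<sigma> by (simp_all add: b_def)
  have A: "0 < A" "A * (2 - \<sigma>) = 2 * b"
    using \<sigma> by (simp_all add: A_def b_def)
  have e: "0 < e" "m * e < 1" "e < 1" "e * (m + A) = 1"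
    using m A by (simp_all add: e_def)
  have scaling: "a * (1 - m * e) = b * e + (b - 1) * (1 - m * e)"
  proof -
    have me: "1 - m * e = A * e"
      using e by (simp add: algebra_simps)
    have "A * (a - b + 1) = A * (2 - \<sigma>) / 2"
      by (simp add: b_def field_simps)
    also have "\<dots> = b"
      using A by simp
    finally have "a * A = b + (b - 1) * A"
      by (simp add: algebra_simps)
    then have "(a * A) * e = (b + (b - 1) * A) * e"
      by simp
    then show ?thesis
      unfolding me by (simp add: algebra_simps)
  qed
  have k: "1 < k" "k * (1 + e) = 2 * k - 2"
    using e by (simp_all add: k_def field_simps)
  have Q: "Q_cr N a \<sigma> = 2 * k - 2"
  proof -
    have "e \<noteq> 1" "m + A - 1 > 0" "1 - e = (m + A - 1) / (m + A)"
      using e A m by (auto simp: e_def field_simps)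
    then have "k = 2 * (m + A) / (m + A - 1)"
      by (simp add: k_def)
    then have "2 * k - 2 = 2 * (m + 1 + A) / (m + 1 + A - 2)"
      using \<open>m + A - 1 > 0\<close> by (simp add: field_simps)
    then show ?thesis
      unfolding Q_cr_def mN A_def[symmetric] by simp
  qed
  define c where "c = (2 * a + 5) * (1 + 2 / b) * (k * sqrt 2 * m)"
  have "0 < 2 * a + 5" "0 < 1 + 2 / b"
    using a b by (simp_all add: add_pos_pos)
  then have c0: "0 < (2 * a + 5) * (1 + 2 / b)" "0 < k * sqrt 2 * m"
    using k m by simp_all
  then have c: "0 < c"
    unfolding c_def by (rule mult_pos_pos)
  then show "0 < c\<^sup>2" by simp
  fix f :: "(real ^ 'n) \<times> real \<Rightarrow> real" assume f: "f \<in> Cc_infty inf_cyl"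
  let ?X = "weighted_power_integral a (2 * k - 2) f" and ?E = "weighted_energy a \<sigma> f"
  let ?K = "cylinder_C1.K (\<lambda>v p. k * (\<bar>f p\<bar> powr (k - 1) * sgn (f p)) * frechet_derivative f (at p) v) a (a + \<sigma> / 2)"
  interpret cylinder_C1 "\<lambda>p. \<bar>f p\<bar> powr k"
    "\<lambda>v p. k * (\<bar>f p\<bar> powr (k - 1) * sgn (f p)) * frechet_derivative f (at p) v" "closure {x. f x \<noteq> 0}"
    by (rule cylinder_C1_abs_powr[OF f k(1)])
  have "?X = (\<integral>\<^sup>+p. bdry_weight a (snd p) * ennreal_powr (ennreal (\<bar>f p\<bar> powr k)) (1 + e) \<partial>lborel)"
    unfolding weighted_power_integral_eq[OF f] by (simp add: powr_powr k)
  also have "\<dots> \<le> ennreal_powr (ennreal ((2 * a + 5) * (1 + 2 / b)) * K a b) (1 + e)"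
    using a b e scaling by (intro weighted_gagliardo_nirenberg) (auto simp: m_def)
  also have "\<dots> \<le> ennreal_powr (ennreal ((2 * a + 5) * (1 + 2 / b)) *
      (ennreal (k * sqrt 2 * m) * (ennreal_powr ?X (1 / 2) * ennreal_powr ?E (1 / 2)))) (1 + e)"
    using K_abs_powr_le[OF f k(1), of a \<sigma>] e by (intro ennreal_powr_mono mult_left_mono) (auto simp: b_def m_def)
  also have "\<dots> = ennreal_powr (ennreal c * (ennreal_powr ?X (1 / 2) * ennreal_powr ?E (1 / 2))) (1 + e)"
    using c0 unfolding c_def by (subst ennreal_mult) (auto simp: mult.assoc)
  finally have "ennreal_powr ?X ((2 - (1 + e)) / (1 + e)) \<le> ennreal (c\<^sup>2) * ?E"
    using weighted_power_integral_finite[OF f a, of "2 * k - 2"] c e k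
    by (intro ennreal_self_absorption) auto
  moreover have "(2 - (1 + e)) / (1 + e) = 2 / (2 * k - 2)"
  proof -
    have "2 * k - 2 = 2 * (1 + e) / (1 - e)"
      using k(2) by (simp add: k_def)
    moreover have "(2 - (1 + e)) / (1 + e) = 2 / (2 * (1 + e) / (1 - e))"
      using e by (simp add: divide_simps) (simp add: algebra_simps)
    ultimately show ?thesis
      by simp
  qed
  ultimately show "weighted_sobolev_ineq (c\<^sup>2) (Q_cr N a \<sigma>) a \<sigma> f"
    unfolding Q weighted_sobolev_ineq_def by simp
qed

text \<open>Hoelder on the finite cylinder, whose mass for the weight \<open>(1 - \<bar>\<lambda>\<bar>)\<^sup>a\<close> is finite since \<open>-1 < a\<close>.\<close>

lemma weighted_sobolev_ineq_lower_exponent: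
  fixes a \<sigma> Q R :: real
  assumes a: "-1 < a" and Q: "0 < Q" "Q < R"
    and R: "\<exists>C>0. \<forall>f \<in> Cc_infty (inf_cyl :: ((real ^ 'n) \<times> real) set). weighted_sobolev_ineq C R a \<sigma> f"
  shows "\<exists>C>0. \<forall>f \<in> Cc_infty (inf_cyl :: ((real ^ 'n) \<times> real) set). weighted_sobolev_ineq C Q a \<sigma> f"
proof -
  obtain C where C: "0 < C" "\<And>f. f \<in> Cc_infty (inf_cyl :: ((real ^ 'n) \<times> real) set) \<Longrightarrow> weighted_sobolev_ineq C R a \<sigma> f"
    using R by blast
  define t where "t = Q / R"
  have t: "0 < t" "t < 1" "R * t = Q"
    using Q by (simp_all add: t_def)
  define V where "V = (\<integral>\<^sup>+p\<in>(fin_cyl :: ((real ^ 'n) \<times> real) set). ennreal ((1 - \<bar>snd p\<bar>) powr a) \<partial>lborel)"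
  have "V < \<infinity>"
    unfolding V_def by (rule weighted_cylinder_mass_finite[OF a])
  then obtain v where v: "V = ennreal v" "0 \<le> v"
    by (metis ennreal_cases less_irrefl infinity_ennreal_def)
  define C' where "C' = (v powr ((1 - t) * (2 / Q)) + 1) * C"
  have C': "0 < C'"
    unfolding C'_def using C by (intro mult_pos_pos add_nonneg_pos) auto
  have "weighted_sobolev_ineq C' Q a \<sigma> f" if f: "f \<in> Cc_infty (inf_cyl :: ((real ^ 'n) \<times> real) set)" for f
  proof -
    have [measurable]: "f \<in> borel_measurable borel"
      by (rule borel_measurable_continuous_onI[OF Cc_infty_continuous[OF f]])
    let ?F = "\<lambda>p. ennreal ((1 - \<bar>snd p\<bar>) powr a * \<bar>f p\<bar> powr R) * indicator fin_cyl p"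
    let ?G = "\<lambda>p::(real ^ 'n) \<times> real. ennreal ((1 - \<bar>snd p\<bar>) powr a) * indicator fin_cyl p"
    have "weighted_power_integral a Q f = (\<integral>\<^sup>+p. ennreal_powr (?F p) t * ennreal_powr (?G p) (1 - t) \<partial>lborel)"
      unfolding weighted_power_integral_def
    proof (intro nn_integral_cong)
      fix p :: "(real ^ 'n) \<times> real"
      let ?s = "(1 - \<bar>snd p\<bar>) powr a"
      have "?s * \<bar>f p\<bar> powr Q = (?s * \<bar>f p\<bar> powr R) powr t * ?s powr (1 - t)"
      proof -
        have "(?s * \<bar>f p\<bar> powr R) powr t * ?s powr (1 - t) = \<bar>f p\<bar> powr (R * t) * (?s powr t * ?s powr (1 - t))"
          by (simp add: powr_mult powr_powr mult_ac)
        also have "?s powr t * ?s powr (1 - t) = ?s"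
          unfolding powr_add[symmetric] by simp
        finally show ?thesis
          using t by (simp add: mult.commute)
      qed
      then show "ennreal (?s * \<bar>f p\<bar> powr Q) * indicator fin_cyl p = ennreal_powr (?F p) t * ennreal_powr (?G p) (1 - t)"
        by (auto simp: indicator_def simp flip: ennreal_mult)
    qed
    also have "\<dots> \<le> ennreal_powr (\<integral>\<^sup>+p. ?F p \<partial>lborel) t * ennreal_powr (\<integral>\<^sup>+p. ?G p \<partial>lborel) (1 - t)"
      using t by (intro nn_integral_Holder) auto
    finally have "weighted_power_integral a Q f
      \<le> ennreal_powr (weighted_power_integral a R f) t * ennreal_powr (ennreal v) (1 - t)"
      unfolding v(1)[symmetric] V_def weighted_power_integral_def .
    then have "ennreal_powr (weighted_power_integral a Q f) (2 / Q)
      \<le> ennreal_powr (ennreal_powr (weighted_power_integral a R f) t * ennreal_powr (ennreal v) (1 - t)) (2 / Q)"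
      using Q by (intro ennreal_powr_mono) auto
    also have "\<dots> = ennreal_powr (weighted_power_integral a R f) (2 / R) * ennreal (v powr ((1 - t) * (2 / Q)))"
    proof -
      have "t * (2 / Q) = 2 / R"
        using Q by (simp add: t_def)
      then show ?thesis
        by (simp only: ennreal_powr_mult ennreal_powr_powr)
          (use v in \<open>simp only: ennreal_powr_ennreal\<close>)
    qed
    also have "\<dots> \<le> (ennreal C * weighted_energy a \<sigma> f) * ennreal (v powr ((1 - t) * (2 / Q)) + 1)"
      using C(2)[OF f] unfolding weighted_sobolev_ineq_def by (intro mult_mono ennreal_leI) auto
    also have "\<dots> = ennreal C' * weighted_energy a \<sigma> f"
      unfolding C'_def using C by (subst ennreal_mult) (auto simp: mult_ac)
    finally show ?thesis
      unfolding weighted_sobolev_ineq_def .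
  qed
  with C' show ?thesis by blast
qed

section \<open>Functions with derivatives of all orders\<close>

lemma frechet_derivative_add_eq:
  assumes "f differentiable (at x)" "g differentiable (at x)"
  shows "frechet_derivative (\<lambda>x. f x + g x) (at x) v = frechet_derivative f (at x) v + frechet_derivative g (at x) v"
proof -
  have "((\<lambda>x. f x + g x) has_derivative (\<lambda>v. frechet_derivative f (at x) v + frechet_derivative g (at x) v)) (at x)"
    using assms by (intro has_derivative_add) (auto simp: frechet_derivative_works)
  from frechet_derivative_at[OF this] show ?thesis
    by metis
qed

lemma frechet_derivative_mult_eq:
  fixes f g :: "'a::real_normed_vector \<Rightarrow> real"
  assumes "f differentiable (at x)" "g differentiable (at x)"
  shows "frechet_derivative (\<lambda>x. f x * g x) (at x) v = f x * frechet_derivative g (at x) v + frechet_derivative f (at x) v * g x"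
proof -
  have "((\<lambda>x. f x * g x) has_derivative (\<lambda>v. f x * frechet_derivative g (at x) v + frechet_derivative f (at x) v * g x)) (at x)"
    using assms by (intro has_derivative_mult) (auto simp: frechet_derivative_works)
  from frechet_derivative_at[OF this] show ?thesis
    by metis
qed

lemma frechet_derivative_chain_real:
  fixes q :: "'a::real_normed_vector \<Rightarrow> real"
  assumes "(h has_real_derivative h') (at (q x))" "q differentiable (at x)"
  shows "((\<lambda>x. h (q x)) has_derivative (\<lambda>v. h' * frechet_derivative q (at x) v)) (at x)"
proof -
  have "(q has_derivative frechet_derivative q (at x)) (at x)"
    using assms by (simp add: frechet_derivative_works)
  from has_derivative_compose[OF this, of h "(*) h'"] assms(1) show ?thesis
    by (simp add: has_field_derivative_def)
qed

lemma Ck_pred: "Ck (Suc k) f \<Longrightarrow> Ck k f"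
proof (induction k arbitrary: f)
  case 0
  then show ?case
    by (auto simp: continuous_on_eq_continuous_at intro: differentiable_imp_continuous_within)
next
  case (Suc k)
  show ?case
    unfolding Ck.simps(2)[of k]
  proof (intro conjI allI)
    show "f differentiable (at x)" for x
      using Suc.prems by simp
    show "Ck k (\<lambda>x. frechet_derivative f (at x) v)" for v
      by (rule Suc.IH) (use Suc.prems in simp)
  qed
qed

lemma Ck_const: "Ck k (\<lambda>x. c)"
proof (induction k arbitrary: c)
  case (Suc k)
  then show ?case by simp
qed simp

lemma Ck_bounded_linear:
  assumes "bounded_linear h"
  shows "Ck k h"
proof (cases k)
  case 0
  then show ?thesis
    using assms by (simp add: linear_continuous_on)
next
  case (Suc n)
  have der: "(h has_derivative h) (at x)" for x
    using assms by (rule bounded_linear_imp_has_derivative)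
  then have "frechet_derivative h (at x) = h" for x
    using frechet_derivative_at by metis
  then show ?thesis
    using Suc der by (auto simp: Ck_const differentiable_def)
qed

lemma Ck_add: "Ck k f \<Longrightarrow> Ck k g \<Longrightarrow> Ck k (\<lambda>x. f x + g x)"
proof (induction k arbitrary: f g)
  case 0
  then show ?case by (simp add: continuous_on_add)
next
  case (Suc k)
  then show ?case
    by (simp add: frechet_derivative_add_eq)
qed

lemma Ck_mult: "Ck k f \<Longrightarrow> Ck k g \<Longrightarrow> Ck k (\<lambda>x. f x * g x)"
proof (induction k arbitrary: f g)
  case 0
  then show ?case by (simp add: continuous_on_mult)
next
  case (Suc k)
  have "Ck k f" "Ck k g"
    using Suc.prems by (auto intro: Ck_pred)
  then show ?case
    using Suc by (simp add: frechet_derivative_mult_eq Ck_add)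
qed

lemma Ck_sum: "(\<And>i. i \<in> I \<Longrightarrow> Ck k (f i)) \<Longrightarrow> Ck k (\<lambda>x. \<Sum>i\<in>I. f i x)"
  by (induction I rule: infinite_finite_induct) (auto simp: Ck_const Ck_add)

text \<open>The functions \<open>x\<^sup>-\<^sup>j exp (-1/x)\<close> for \<open>x > 0\<close>, extended by zero. The factor \<open>x\<^sup>-\<^sup>j\<close> is carried along because
  the family is closed under differentiation: the derivative of the \<open>j\<close>-th function is a combination of
  those with indices \<open>j + 1\<close> and \<open>j + 2\<close>. This gives smoothness of all of them by one induction.\<close>

definition flat_exp :: "nat \<Rightarrow> real \<Rightarrow> real" where
  "flat_exp j x = (if 0 < x then inverse x ^ j * exp (- inverse x) else 0)"

lemma flat_exp_nonpos: "x \<le> 0 \<Longrightarrow> flat_exp j x = 0"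
  by (simp add: flat_exp_def)

lemma flat_exp_nonneg: "0 \<le> flat_exp j x"
  by (simp add: flat_exp_def)

lemma flat_exp_tendsto_0: "(flat_exp j \<longlongrightarrow> 0) (at 0)"
proof (rule filterlim_split_at)
  have "((\<lambda>x::real. inverse x ^ j / exp (inverse x)) \<longlongrightarrow> 0) (at_right 0)"
    by (rule filterlim_compose[OF tendsto_power_div_exp_0 filterlim_inverse_at_top_right])
  moreover have "eventually (\<lambda>x::real. inverse x ^ j / exp (inverse x) = flat_exp j x) (at_right 0)"
    using eventually_at_right_less[of "0::real"]
    by eventually_elim (simp add: flat_exp_def exp_minus divide_inverse)
  ultimately show "(flat_exp j \<longlongrightarrow> 0) (at_right 0)"
    by (rule Lim_transform_eventually)
  have "eventually (\<lambda>x::real. 0 = flat_exp j x) (at_left 0)"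
    by (auto simp: eventually_at_filter flat_exp_def)
  then show "(flat_exp j \<longlongrightarrow> 0) (at_left 0)"
    by (rule Lim_transform_eventually[OF tendsto_const])
qed

lemma DERIV_flat_exp:
  "(flat_exp j has_real_derivative (- real j * flat_exp (j + 1) x + flat_exp (j + 2) x)) (at x)"
proof -
  consider "x = 0" | "x < 0" | "x > 0" by linarith
  then show ?thesis
  proof cases
    case 1
    have quot: "(\<lambda>h. (flat_exp j (0 + h) - flat_exp j 0) / h) = flat_exp (j + 1)"
      by (simp add: fun_eq_iff flat_exp_def divide_inverse)
    have "(flat_exp j has_real_derivative 0) (at 0)"
      unfolding DERIV_def quot by (rule flat_exp_tendsto_0)
    then show ?thesis
      using 1 by (simp add: flat_exp_nonpos)
  next
    case 2
    have ev: "eventually (\<lambda>y. flat_exp j y = 0) (nhds x)"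
      using eventually_nhds_in_open[of "{..<0}" x] 2
      by (auto elim!: eventually_mono simp: flat_exp_nonpos)
    show ?thesis
      unfolding DERIV_cong_ev[OF refl ev refl] using 2 by (simp add: flat_exp_nonpos)
  next
    case 3
    have ev: "eventually (\<lambda>y. flat_exp j y = inverse y ^ j * exp (- inverse y)) (nhds x)"
      using eventually_nhds_in_open[of "{0<..}" x] 3
      by (auto elim!: eventually_mono simp: flat_exp_def)
    have pw: "real j * inverse x ^ (j - Suc 0) * inverse (x\<^sup>2) = real j * inverse x ^ (j + 1)"
      by (cases j) (simp_all add: power2_eq_square)
    have "((\<lambda>y. inverse y ^ j * exp (- inverse y)) has_real_derivative
      inverse x ^ j * (exp (- inverse x) * inverse (x\<^sup>2))
        - (real j * inverse x ^ (j - Suc 0) * inverse (x\<^sup>2)) * exp (- inverse x)) (at x)"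
      using 3 by (auto intro!: derivative_eq_intros simp: power2_eq_square)
    also have "inverse x ^ j * (exp (- inverse x) * inverse (x\<^sup>2))
        - (real j * inverse x ^ (j - Suc 0) * inverse (x\<^sup>2)) * exp (- inverse x)
        = - real j * flat_exp (j + 1) x + flat_exp (j + 2) x"
      unfolding pw using 3 by (simp add: flat_exp_def power2_eq_square)
    finally show ?thesis
      unfolding DERIV_cong_ev[OF refl ev refl] .
  qed
qed

lemma Ck_flat_exp:
  assumes q: "\<And>k. Ck k q"
  shows "Ck k (\<lambda>x. flat_exp j (q x))"
proof (induction k arbitrary: j)
  case 0
  have "continuous_on UNIV (flat_exp j)"
    using DERIV_flat_exp by (blast intro: DERIV_isCont continuous_at_imp_continuous_on)
  then show ?case
    using q[of 0] by (auto intro: continuous_on_compose2)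
next
  case (Suc k)
  have d: "((\<lambda>x. flat_exp j (q x)) has_derivative
      (\<lambda>v. (- real j * flat_exp (j + 1) (q x) + flat_exp (j + 2) (q x)) * frechet_derivative q (at x) v)) (at x)" for x
    using q[of "Suc 0"] by (intro frechet_derivative_chain_real DERIV_flat_exp) simp
  have "Ck k (\<lambda>x. (- real j * flat_exp (j + 1) (q x) + flat_exp (j + 2) (q x)) * frechet_derivative q (at x) v)" for v
    using q[of "Suc k"] by (intro Ck_mult Ck_add Ck_const Suc) simp
  then show ?case
    using d frechet_derivative_at[OF d, symmetric] by (auto simp: differentiable_def)
qed

lemma flat_exp_bounded: "\<exists>M>0. \<forall>x\<le>1. flat_exp j x \<le> M"
proof -
  have "continuous_on {0..1} (flat_exp j)"
    using DERIV_flat_exp by (blast intro: DERIV_isCont continuous_at_imp_continuous_on)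
  then have "bounded (flat_exp j ` {0..1})"
    by (intro compact_imp_bounded compact_continuous_image) auto
  then obtain M where "\<forall>y\<in>flat_exp j ` {0..1}. norm y \<le> M"
    unfolding bounded_iff by blast
  then have M: "\<bar>flat_exp j x\<bar> \<le> M" if "x \<in> {0..1}" for x
    using that by auto
  have "flat_exp j x \<le> \<bar>M\<bar> + 1" if "x \<le> 1" for x
    using M[of x] that by (cases "0 \<le> x") (auto simp: flat_exp_nonpos)
  then show ?thesis
    by (intro exI[of _ "\<bar>M\<bar> + 1"]) auto
qed

section \<open>Bumps concentrating at the end of the cylinder\<close>

text \<open>The first factor lives on \<open>\<bar>x'\<bar> < 1/2\<close>, the second on \<open>\<tau> < 1 - \<lambda> < 2\<tau>\<close>.\<close>

definition bump :: "real \<Rightarrow> (real ^ 'n) \<times> real \<Rightarrow> real" where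
  "bump \<tau> p = flat_exp 0 (1 / 4 - fst p \<bullet> fst p)
     * flat_exp 0 (((1 - snd p) / \<tau> - 1) * (2 - (1 - snd p) / \<tau>))"

lemma Ck_bump: "Ck k (bump \<tau> :: (real ^ 'n) \<times> real \<Rightarrow> real)"
proof -
  have lin: "Ck k (\<lambda>p::(real ^ 'n) \<times> real. fst p \<bullet> b)" "Ck k (\<lambda>p::(real ^ 'n) \<times> real. snd p)" for b k
    by (intro Ck_bounded_linear bounded_linear_intros)+
  have "Ck k (\<lambda>p::(real ^ 'n) \<times> real. 1 / 4 + (- 1) * (\<Sum>b\<in>Basis. (fst p \<bullet> b) * (fst p \<bullet> b)))" for k
    by (intro Ck_add Ck_mult Ck_sum Ck_const lin)
  then have q1: "Ck k (\<lambda>p::(real ^ 'n) \<times> real. 1 / 4 - fst p \<bullet> fst p)" for k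
    by (subst euclidean_inner) simp
  have "Ck k (\<lambda>p::(real ^ 'n) \<times> real. ((1 / \<tau> - 1) + (- 1 / \<tau>) * snd p) * ((2 - 1 / \<tau>) + (1 / \<tau>) * snd p))" for k
    by (intro Ck_add Ck_mult Ck_const lin)
  moreover have "((1 / \<tau> - 1) + (- 1 / \<tau>) * l) * ((2 - 1 / \<tau>) + (1 / \<tau>) * l)
      = ((1 - l) / \<tau> - 1) * (2 - (1 - l) / \<tau>)" for l
    by (simp add: diff_divide_distrib algebra_simps)
  ultimately have q2: "Ck k (\<lambda>p::(real ^ 'n) \<times> real. ((1 - snd p) / \<tau> - 1) * (2 - (1 - snd p) / \<tau>))" for k
    by simp
  show ?thesis
    unfolding bump_def by (intro Ck_mult Ck_flat_exp q1 q2)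
qed

lemma bump_support:
  fixes p :: "(real ^ 'n) \<times> real"
  assumes "0 < \<tau>"
    and "0 < 1 / 4 - fst p \<bullet> fst p" "0 < ((1 - snd p) / \<tau> - 1) * (2 - (1 - snd p) / \<tau>)"
  shows "p \<in> cball (0 :: real ^ 'n) (1 / 2) \<times> {1 - 2 * \<tau>..1 - \<tau>}"
proof -
  have "(norm (fst p))\<^sup>2 < (1 / 2)\<^sup>2"
    using assms(2) unfolding power2_norm_eq_inner by (simp add: power2_eq_square)
  then have "norm (fst p) < 1 / 2"
    by (rule power2_less_imp_less) simp
  moreover have "1 < (1 - snd p) / \<tau>" "(1 - snd p) / \<tau> < 2"
    using assms(3) by (auto simp: zero_less_mult_iff)
  then have "\<tau> < 1 - snd p" "1 - snd p < 2 * \<tau>"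
    using assms(1) by (simp_all add: field_simps)
  ultimately show ?thesis
    by (cases p) auto
qed

lemma bump_in_Cc_infty:
  assumes "0 < \<tau>" "\<tau> < 1 / 2"
  shows "bump \<tau> \<in> Cc_infty (fin_cyl :: ((real ^ 'n) \<times> real) set)"
proof -
  let ?B = "cball (0 :: real ^ 'n) (1 / 2) \<times> {1 - 2 * \<tau>..1 - \<tau>}"
  have "{p. bump \<tau> p \<noteq> 0} \<subseteq> ?B"
  proof
    fix p :: "(real ^ 'n) \<times> real" assume "p \<in> {p. bump \<tau> p \<noteq> 0}"
    then have "0 < 1 / 4 - fst p \<bullet> fst p" "0 < ((1 - snd p) / \<tau> - 1) * (2 - (1 - snd p) / \<tau>)"
      by (auto simp: bump_def flat_exp_def split: if_splits)
    then show "p \<in> ?B"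
      by (rule bump_support[OF assms(1)])
  qed
  moreover have compact: "compact ?B"
    by (intro compact_Times) auto
  ultimately have sub: "closure {p. bump \<tau> p \<noteq> 0} \<subseteq> ?B"
    by (intro closure_minimal compact_imp_closed) auto
  then have "compact (closure {p. bump \<tau> p \<noteq> (0::real)} :: ((real ^ 'n) \<times> real) set)"
    using compact by (metis closed_closure compact_Int_closed inf.absorb_iff2)
  moreover have "?B \<subseteq> fin_cyl"
    using assms by (auto simp: fin_cyl_def)
  ultimately show ?thesis
    using sub Ck_bump unfolding Cc_infty_def by auto
qed

lemma bump_derivative:
  fixes p :: "(real ^ 'n) \<times> real"
  assumes \<tau>: "0 < \<tau>"
  defines "s \<equiv> (1 - snd p) / \<tau>"
  shows "frechet_derivative (bump \<tau>) (at p) v =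
    flat_exp 2 (1 / 4 - fst p \<bullet> fst p) * (- 2 * (fst p \<bullet> fst v)) * flat_exp 0 ((s - 1) * (2 - s))
    + flat_exp 0 (1 / 4 - fst p \<bullet> fst p) * (flat_exp 2 ((s - 1) * (2 - s)) * ((3 - 2 * s) * (- snd v / \<tau>)))"
proof -
  have D: "(flat_exp 0 has_derivative (\<lambda>h. flat_exp 2 x * h)) (at x)" for x
    using DERIV_flat_exp[of 0 x] by (simp add: has_field_derivative_def numeral_2_eq_2)
  have q1: "((\<lambda>p::(real ^ 'n) \<times> real. 1 / 4 - fst p \<bullet> fst p) has_derivative (\<lambda>v. - 2 * (fst p \<bullet> fst v))) (at p)"
    by (auto intro!: derivative_eq_intros simp: inner_commute)
  have q2: "((\<lambda>p::(real ^ 'n) \<times> real. ((1 - snd p) / \<tau> - 1) * (2 - (1 - snd p) / \<tau>)) has_derivative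
      (\<lambda>v. (3 - 2 * s) * (- snd v / \<tau>))) (at p)"
    unfolding s_def using \<tau> by (auto intro!: derivative_eq_intros simp: fun_eq_iff field_simps)
  have "(bump \<tau> has_derivative (\<lambda>v.
      flat_exp 0 (1 / 4 - fst p \<bullet> fst p) * (flat_exp 2 ((s - 1) * (2 - s)) * ((3 - 2 * s) * (- snd v / \<tau>)))
      + flat_exp 2 (1 / 4 - fst p \<bullet> fst p) * (- 2 * (fst p \<bullet> fst v)) * flat_exp 0 ((s - 1) * (2 - s)))) (at p)"
    unfolding bump_def s_def
    using has_derivative_mult[OF has_derivative_compose[OF q1 D] has_derivative_compose[OF q2 D]]
    by (simp add: s_def)
  from frechet_derivative_at[OF this, symmetric] show ?thesis
    by simp
qed

lemma emeasure_lborel_Times_Icc: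
  fixes A :: "(real ^ 'n) set"
  assumes "A \<in> sets borel" "a \<le> b"
  shows "emeasure lborel (A \<times> {a..b}) = emeasure lborel A * ennreal (b - a)"
proof -
  have "emeasure lborel (A \<times> {a..b}) = emeasure (lborel \<Otimes>\<^sub>M lborel) (A \<times> {a..b})"
    by (simp only: lborel_prod)
  also have "\<dots> = emeasure lborel A * emeasure lborel {a..b}"
    using assms by (intro lborel.emeasure_pair_measure_Times) auto
  finally show ?thesis
    using assms by simp
qed

section \<open>Failure of the inequality in the limit case\<close>

lemma powr_between_1_2:
  fixes s a :: real
  assumes "1 \<le> s" "s \<le> 2"
  shows "s powr a \<le> 2 powr \<bar>a\<bar>" "2 powr (- \<bar>a\<bar>) \<le> s powr a"
proof -
  have "s powr a \<le> s powr \<bar>a\<bar>"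
    using assms by (intro powr_mono) auto
  also have "\<dots> \<le> 2 powr \<bar>a\<bar>"
    using assms by (intro powr_mono2) auto
  finally show "s powr a \<le> 2 powr \<bar>a\<bar>" .
  have "2 powr (- \<bar>a\<bar>) \<le> s powr (- \<bar>a\<bar>)"
    using assms by (intro powr_mono2') auto
  also have "\<dots> \<le> s powr a"
    using assms by (intro powr_mono) auto
  finally show "2 powr (- \<bar>a\<bar>) \<le> s powr a" .
qed

text \<open>On the support \<open>1 - \<bar>\<lambda>\<bar>\<close> lies between \<open>\<tau>\<close> and \<open>2\<tau>\<close>, while \<open>\<partial>\<^sub>\<lambda>\<close> of the bump is of order \<open>1/\<tau>\<close>; for \<open>\<sigma> = 2\<close> the
  weight cancels this, so the energy density is of order \<open>\<tau>\<^sup>a\<close> on a set of measure of order \<open>\<tau>\<close>.\<close>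

lemma bump_energy_le:
  obtains c where "0 < c" "\<And>\<tau>. 0 < \<tau> \<Longrightarrow> \<tau> < 1 / 2 \<Longrightarrow>
    weighted_energy a 2 (bump \<tau> :: (real ^ 'n) \<times> real \<Rightarrow> real) \<le> ennreal (c * \<tau> powr (a + 1))"
proof -
  obtain M0 where M0: "0 < M0" "\<And>x. x \<le> 1 \<Longrightarrow> flat_exp 0 x \<le> M0"
    using flat_exp_bounded[of 0] by blast
  obtain M2 where M2: "0 < M2" "\<And>x. x \<le> 1 \<Longrightarrow> flat_exp 2 x \<le> M2"
    using flat_exp_bounded[of 2] by blast
  obtain V where V: "0 \<le> V" "emeasure lborel (cball (0 :: real ^ 'n) (1 / 2)) = ennreal V"
    using emeasure_lborel_cball_finite[of "0 :: real ^ 'n" "1 / 2"]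
    by (metis ennreal_cases infinity_ennreal_def less_irrefl)
  define M where "M = M0 * M2"
  have M: "0 < M" using M0 M2 by (simp add: M_def)
  define c where "c = 2 powr \<bar>a\<bar> * (5 * M\<^sup>2)"
  have c: "0 < c" using M by (simp add: c_def)
  have "weighted_energy a 2 (bump \<tau> :: (real ^ 'n) \<times> real \<Rightarrow> real) \<le> ennreal (c * (V + 1) * \<tau> powr (a + 1))"
    if \<tau>: "0 < \<tau>" "\<tau> < 1 / 2" for \<tau>
  proof -
    let ?B = "cball (0 :: real ^ 'n) (1 / 2) \<times> {1 - 2 * \<tau>..1 - \<tau>}"
    have "weighted_energy a 2 (bump \<tau> :: (real ^ 'n) \<times> real \<Rightarrow> real)
      \<le> (\<integral>\<^sup>+p. ennreal (c * \<tau> powr a) * indicator ?B p \<partial>lborel)"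
      unfolding weighted_energy_def
    proof (intro nn_integral_mono)
      fix p :: "(real ^ 'n) \<times> real"
      define s where "s = (1 - snd p) / \<tau>"
      define q1 where "q1 = 1 / 4 - fst p \<bullet> fst p"
      define q2 where "q2 = (s - 1) * (2 - s)"
      have g: "grad_x' (bump \<tau>) p = (- 2 * flat_exp 2 q1 * flat_exp 0 q2) *\<^sub>R fst p"
        using \<tau> by (simp add: grad_x'_def bump_derivative vec_eq_iff q1_def q2_def s_def inner_axis)
      have d: "d_lambda (bump \<tau>) p = - (flat_exp 0 q1 * flat_exp 2 q2 * (3 - 2 * s)) / \<tau>"
        using \<tau> by (simp add: d_lambda_def bump_derivative q1_def q2_def s_def)
      show "ennreal ((1 - \<bar>snd p\<bar>) powr a * ((norm (grad_x' (bump \<tau>) p))\<^sup>2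
          + (1 - \<bar>snd p\<bar>) powr 2 * (d_lambda (bump \<tau>) p)\<^sup>2)) * indicator fin_cyl p
        \<le> ennreal (c * \<tau> powr a) * indicator ?B p"
      proof (cases "0 < q1 \<and> 0 < q2")
        case False
        then have "flat_exp 2 q1 * flat_exp 0 q2 = 0" "flat_exp 0 q1 * flat_exp 2 q2 = 0"
          by (auto simp: flat_exp_nonpos not_less)
        then have "norm (grad_x' (bump \<tau>) p) = 0" "d_lambda (bump \<tau>) p = 0"
          unfolding g d by auto
        then show ?thesis by simp
      next
        case True
        then have B: "p \<in> ?B"
          using bump_support[OF \<tau>(1), of p] by (simp add: q1_def q2_def s_def)
        then have nx: "norm (fst p) \<le> 1 / 2" and l: "1 - 2 * \<tau> \<le> snd p" "snd p \<le> 1 - \<tau>"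
          by (auto simp: mem_Times_iff)
        have t: "1 - \<bar>snd p\<bar> = s * \<tau>"
          using l \<tau> by (simp add: s_def)
        have s: "1 \<le> s" "s \<le> 2"
          using l \<tau> by (simp_all add: s_def field_simps)
        have "q1 \<le> 1"
          using inner_ge_zero[of "fst p"] unfolding q1_def by linarith
        moreover have "q2 \<le> 1"
          using s mult_mono[of "s - 1" 1 "2 - s" 1] by (simp add: q2_def)
        ultimately have fl: "flat_exp 0 q1 \<le> M0" "flat_exp 0 q2 \<le> M0" "flat_exp 2 q1 \<le> M2" "flat_exp 2 q2 \<le> M2"
          by (auto intro: M0 M2)
        have prod: "flat_exp 2 q1 * flat_exp 0 q2 \<le> M" "flat_exp 0 q1 * flat_exp 2 q2 \<le> M"
          unfolding M_def using fl M0(1) M2(1)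
            mult_mono[of "flat_exp 0 q2" M0 "flat_exp 2 q1" M2] mult_mono[of "flat_exp 0 q1" M0 "flat_exp 2 q2" M2]
          by (simp_all add: flat_exp_nonneg mult.commute)
        have gM: "norm (grad_x' (bump \<tau>) p) \<le> M"
        proof -
          have "norm (grad_x' (bump \<tau>) p) = 2 * (flat_exp 2 q1 * flat_exp 0 q2) * norm (fst p)"
            unfolding g by (simp add: abs_mult flat_exp_nonneg)
          also have "\<dots> \<le> 2 * M * (1 / 2)"
            using prod(1) nx M by (intro mult_mono) (auto simp: flat_exp_nonneg)
          finally show ?thesis by simp
        qed
        have dM: "(s * \<tau>) powr 2 * (d_lambda (bump \<tau>) p)\<^sup>2 \<le> 4 * M\<^sup>2"
        proof -
          have "\<bar>3 - 2 * s\<bar> \<le> 1"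
            using s by linarith
          then have "\<bar>flat_exp 0 q1 * flat_exp 2 q2 * (3 - 2 * s)\<bar> \<le> M * 1"
            unfolding abs_mult[of "flat_exp 0 q1 * flat_exp 2 q2"]
            using prod(2) M by (intro mult_mono) (auto simp: abs_mult flat_exp_nonneg)
          then have "s * \<bar>flat_exp 0 q1 * flat_exp 2 q2 * (3 - 2 * s)\<bar> \<le> 2 * (M * 1)"
            using s M by (intro mult_mono) auto
          then have "(s * \<bar>flat_exp 0 q1 * flat_exp 2 q2 * (3 - 2 * s)\<bar>)\<^sup>2 \<le> (2 * M)\<^sup>2"
            using s by (intro power_mono) auto
          moreover have "(s * \<tau>) powr 2 * (d_lambda (bump \<tau>) p)\<^sup>2
              = (s * \<bar>flat_exp 0 q1 * flat_exp 2 q2 * (3 - 2 * s)\<bar>)\<^sup>2"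
            unfolding d using s \<tau> by (simp add: power_mult_distrib power_divide)
          ultimately show ?thesis
            by (simp add: power_mult_distrib)
        qed
        have "(s * \<tau>) powr a * ((norm (grad_x' (bump \<tau>) p))\<^sup>2 + (s * \<tau>) powr 2 * (d_lambda (bump \<tau>) p)\<^sup>2)
          \<le> (2 powr \<bar>a\<bar> * \<tau> powr a) * (M\<^sup>2 + 4 * M\<^sup>2)"
        proof (rule mult_mono)
          show "(s * \<tau>) powr a \<le> 2 powr \<bar>a\<bar> * \<tau> powr a"
            using s \<tau> powr_between_1_2[OF s, of a] by (simp add: powr_mult mult_right_mono)
          show "(norm (grad_x' (bump \<tau>) p))\<^sup>2 + (s * \<tau>) powr 2 * (d_lambda (bump \<tau>) p)\<^sup>2
              \<le> M\<^sup>2 + 4 * M\<^sup>2"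
            using gM by (intro add_mono dM power_mono) auto
        qed auto
        also have "\<dots> = c * \<tau> powr a"
          by (simp add: c_def)
        finally show ?thesis
          unfolding t using B by (auto simp: indicator_def intro!: ennreal_leI)
      qed
    qed
    also have "\<dots> = ennreal (c * \<tau> powr a) * emeasure lborel ?B"
      by (intro nn_integral_cmult_indicator) (simp add: borel_closed closed_Times)
    also have "\<dots> = ennreal (c * \<tau> powr a * (V * \<tau>))"
      using \<tau> c V by (subst emeasure_lborel_Times_Icc) (auto simp flip: ennreal_mult)
    also have "\<dots> \<le> ennreal (c * (V + 1) * \<tau> powr (a + 1))"
      using \<tau> c V by (intro ennreal_leI) (simp add: powr_add algebra_simps)
    finally show ?thesis .
  qed
  moreover have "0 < c * (V + 1)"
    using c V by simp
  ultimately show ?thesis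
    using that by blast
qed

text \<open>The bump is bounded below on a smaller box inside its support, on which both arguments of
  \<open>flat_exp\<close> are at least \<open>3/16\<close>: \<open>1/4 - 1/16\<close> for the first, \<open>1/4 \<cdot> 3/4\<close> at the worst point for the second.\<close>

lemma bump_power_integral_ge:
  assumes Q: "0 < Q"
  obtains c where "0 < c" "\<And>\<tau>. 0 < \<tau> \<Longrightarrow> \<tau> < 1 / 2 \<Longrightarrow>
    ennreal (c * \<tau> powr (a + 1)) \<le> weighted_power_integral a Q (bump \<tau> :: (real ^ 'n) \<times> real \<Rightarrow> real)"
proof -
  define V where "V = measure lborel (cball (0 :: real ^ 'n) (1 / 4))"
  have V: "0 < V" "emeasure lborel (cball (0 :: real ^ 'n) (1 / 4)) = ennreal V"
    using emeasure_lborel_cball_finite[of "0 :: real ^ 'n" "1 / 4"]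
    by (auto simp: V_def content_cball_pos intro!: emeasure_eq_ennreal_measure)
  \<comment> \<open>The value of \<open>flat_exp 0\<close> at \<open>3/16\<close>.\<close>
  define u where "u = exp (- 16 / 3 :: real)"
  have u: "u \<le> flat_exp 0 x" if "3 / 16 \<le> x" for x
    using that by (auto simp: flat_exp_def u_def field_simps)
  define c where "c = 2 powr (- \<bar>a\<bar>) * (u * u) powr Q"
  have c: "0 < c" by (simp add: c_def u_def)
  have "ennreal (c * (V / 2) * \<tau> powr (a + 1)) \<le> weighted_power_integral a Q (bump \<tau> :: (real ^ 'n) \<times> real \<Rightarrow> real)"
    if \<tau>: "0 < \<tau>" "\<tau> < 1 / 2" for \<tau>
  proof -
    let ?B = "cball (0 :: real ^ 'n) (1 / 4) \<times> {1 - 7 / 4 * \<tau>..1 - 5 / 4 * \<tau>}"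
    have "ennreal (c * (V / 2) * \<tau> powr (a + 1)) = ennreal (c * \<tau> powr a * (V * (\<tau> / 2)))"
      using \<tau> by (simp add: powr_add algebra_simps)
    also have "\<dots> = ennreal (c * \<tau> powr a) * emeasure lborel ?B"
      using \<tau> c V by (subst emeasure_lborel_Times_Icc) (auto simp flip: ennreal_mult)
    also have "\<dots> = (\<integral>\<^sup>+p. ennreal (c * \<tau> powr a) * indicator ?B p \<partial>lborel)"
      by (intro nn_integral_cmult_indicator[symmetric]) (simp add: borel_closed closed_Times)
    also have "\<dots> \<le> weighted_power_integral a Q (bump \<tau> :: (real ^ 'n) \<times> real \<Rightarrow> real)"
      unfolding weighted_power_integral_def
    proof (intro nn_integral_mono)
      fix p :: "(real ^ 'n) \<times> real"
      show "ennreal (c * \<tau> powr a) * indicator ?B p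
        \<le> ennreal ((1 - \<bar>snd p\<bar>) powr a * \<bar>bump \<tau> p\<bar> powr Q) * indicator fin_cyl p"
      proof (cases "p \<in> ?B")
        case True
        define s where "s = (1 - snd p) / \<tau>"
        have nx: "norm (fst p) \<le> 1 / 4" and l: "1 - 7 / 4 * \<tau> \<le> snd p" "snd p \<le> 1 - 5 / 4 * \<tau>"
          using True by (auto simp: mem_Times_iff)
        have t: "1 - \<bar>snd p\<bar> = s * \<tau>"
          using l \<tau> by (simp add: s_def)
        have s: "5 / 4 \<le> s" "s \<le> 7 / 4"
          using l \<tau> by (simp_all add: s_def field_simps)
        have fc: "p \<in> fin_cyl"
          using nx l \<tau> by (simp add: mem_fin_cyl_iff abs_less_iff)
        have "(norm (fst p))\<^sup>2 \<le> (1 / 4)\<^sup>2"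
          using nx by (intro power_mono) auto
        then have q1: "3 / 16 \<le> 1 / 4 - fst p \<bullet> fst p"
          unfolding power2_norm_eq_inner by (simp add: power2_eq_square)
        have "0 \<le> (s - 5 / 4) * (7 / 4 - s)"
          using s by (intro mult_nonneg_nonneg) auto
        then have q2: "3 / 16 \<le> (s - 1) * (2 - s)"
          by (simp add: algebra_simps)
        have "u * u \<le> bump \<tau> p"
          unfolding bump_def s_def[symmetric]
          using u[OF q1] u[OF q2] by (intro mult_mono) (auto simp: u_def flat_exp_nonneg)
        then have "(u * u) powr Q \<le> \<bar>bump \<tau> p\<bar> powr Q"
          using Q by (intro powr_mono2) (auto simp: u_def)
        then have "(2 powr (- \<bar>a\<bar>) * \<tau> powr a) * (u * u) powr Q \<le> (s * \<tau>) powr a * \<bar>bump \<tau> p\<bar> powr Q"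
          using powr_between_1_2(2)[of s a] s \<tau>
          by (intro mult_mono) (auto simp: powr_mult intro!: mult_right_mono)
        then have "c * \<tau> powr a \<le> (1 - \<bar>snd p\<bar>) powr a * \<bar>bump \<tau> p\<bar> powr Q"
          by (simp add: c_def t mult_ac)
        then show ?thesis
          using fc by (auto simp: indicator_def intro!: ennreal_leI)
      qed simp
    qed
    finally show ?thesis .
  qed
  moreover have "0 < c * (V / 2)"
    using c V by simp
  ultimately show ?thesis
    using that by blast
qed

text \<open>Tested on the bumps, the inequality bounds a positive constant by a multiple of
  \<open>\<tau>\<^sup>(\<^sup>a\<^sup>+\<^sup>1\<^sup>)\<^sup>(\<^sup>1\<^sup>-\<^sup>2\<^sup>/\<^sup>Q\<^sup>)\<close>, which tends to zero with \<open>\<tau>\<close>.\<close>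

lemma weighted_sobolev_ineq_sigma_2_fails:
  assumes a: "-1 < a" and Q: "2 < Q"
  shows "\<not> (\<forall>f \<in> Cc_infty (fin_cyl :: ((real ^ 'n) \<times> real) set). weighted_sobolev_ineq C Q a 2 f)"
proof
  assume *: "\<forall>f \<in> Cc_infty (fin_cyl :: ((real ^ 'n) \<times> real) set). weighted_sobolev_ineq C Q a 2 f"
  obtain c where c: "0 < c" "\<And>\<tau>. 0 < \<tau> \<Longrightarrow> \<tau> < 1 / 2 \<Longrightarrow>
    ennreal (c * \<tau> powr (a + 1)) \<le> weighted_power_integral a Q (bump \<tau> :: (real ^ 'n) \<times> real \<Rightarrow> real)"
    using bump_power_integral_ge[of Q a] Q by auto
  obtain d where d: "0 < d" "\<And>\<tau>. 0 < \<tau> \<Longrightarrow> \<tau> < 1 / 2 \<Longrightarrow>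
    weighted_energy a 2 (bump \<tau> :: (real ^ 'n) \<times> real \<Rightarrow> real) \<le> ennreal (d * \<tau> powr (a + 1))"
    using bump_energy_le[of a] by auto
  \<comment> \<open>The power of \<open>\<tau>\<close> by which the energy is smaller than the left side.\<close>
  define k where "k = (a + 1) * (1 - 2 / Q)"
  have k: "0 < k"
    using a Q by (simp add: k_def)
  have main: "c powr (2 / Q) \<le> max C 0 * d * \<tau> powr k" if \<tau>: "0 < \<tau>" "\<tau> < 1 / 2" for \<tau>
  proof -
    have "ennreal ((c * \<tau> powr (a + 1)) powr (2 / Q)) = ennreal_powr (ennreal (c * \<tau> powr (a + 1))) (2 / Q)"
      using c by simp
    also have "\<dots> \<le> ennreal_powr (weighted_power_integral a Q (bump \<tau> :: (real ^ 'n) \<times> real \<Rightarrow> real)) (2 / Q)"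
      using c(2)[OF \<tau>] Q by (intro ennreal_powr_mono) auto
    also have "\<dots> \<le> ennreal C * weighted_energy a 2 (bump \<tau> :: (real ^ 'n) \<times> real \<Rightarrow> real)"
      using * bump_in_Cc_infty[OF \<tau>] unfolding weighted_sobolev_ineq_def by blast
    also have "\<dots> \<le> ennreal (max C 0) * ennreal (d * \<tau> powr (a + 1))"
      using d(2)[OF \<tau>] by (intro mult_mono ennreal_leI) auto
    also have "\<dots> = ennreal (max C 0 * (d * \<tau> powr (a + 1)))"
      using d by (intro ennreal_mult[symmetric]) auto
    finally have "(c * \<tau> powr (a + 1)) powr (2 / Q) \<le> max C 0 * (d * \<tau> powr (a + 1))"
      using d by (subst (asm) ennreal_le_iff) auto
    moreover have "(c * \<tau> powr (a + 1)) powr (2 / Q) = c powr (2 / Q) * \<tau> powr ((a + 1) * (2 / Q))"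
      using c by (simp add: powr_mult powr_powr)
    moreover have "\<tau> powr (a + 1) = \<tau> powr k * \<tau> powr ((a + 1) * (2 / Q))"
      unfolding powr_add[symmetric] k_def by (simp add: algebra_simps)
    ultimately have "c powr (2 / Q) * \<tau> powr ((a + 1) * (2 / Q))
      \<le> (max C 0 * d * \<tau> powr k) * \<tau> powr ((a + 1) * (2 / Q))"
      by (simp add: mult_ac)
    then show ?thesis
      using \<tau> by (subst (asm) mult_le_cancel_right) auto
  qed
  have "((\<lambda>\<tau>. \<tau> powr k) \<longlongrightarrow> 0) (at_right (0::real))"
    using k by (intro tendsto_zero_powrI[where b=k] tendsto_intros)
      (auto simp: eventually_at_filter)
  then have "((\<lambda>\<tau>. max C 0 * d * \<tau> powr k) \<longlongrightarrow> max C 0 * d * 0) (at_right (0::real))"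
    by (intro tendsto_intros)
  moreover have "eventually (\<lambda>\<tau>. c powr (2 / Q) \<le> max C 0 * d * \<tau> powr k) (at_right (0::real))"
    using eventually_at_right_real[of 0 "1 / 2 :: real"] by (auto elim!: eventually_mono intro: main)
  ultimately have "c powr (2 / Q) \<le> max C 0 * d * 0"
    by (intro tendsto_lowerbound) auto
  then show False
    using c by simp
qed

section \<open>The weighted Sobolev inequality and its limit case\<close>

theorem theorem1p1:
  fixes N :: nat and \<alpha> :: real
  assumes "N \<ge> 2" and "CARD('n::finite) = N - 1" and "\<alpha> > -1"
  shows "(\<forall>\<sigma> Q. - 2 * \<alpha> < \<sigma> \<and> \<sigma> < 2 \<and> 2 \<le> Q \<and> Q \<le> Q_cr N \<alpha> \<sigma> \<longrightarrow>
            (\<exists>C>0. \<forall>f \<in> Cc_infty (inf_cyl :: ((real ^ 'n) \<times> real) set).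
               weighted_sobolev_ineq C Q \<alpha> \<sigma> f))
       \<and> (\<exists>C>0. \<forall>f \<in> Cc_infty (inf_cyl :: ((real ^ 'n) \<times> real) set).
               weighted_sobolev_ineq C 2 \<alpha> 2 f)
       \<and> (\<forall>Q>2. \<not> (\<exists>C. \<forall>f \<in> Cc_infty (fin_cyl :: ((real ^ 'n) \<times> real) set).
               weighted_sobolev_ineq C Q \<alpha> 2 f))"
proof (intro conjI allI impI)
  fix \<sigma> Q :: real
  assume Q: "- 2 * \<alpha> < \<sigma> \<and> \<sigma> < 2 \<and> 2 \<le> Q \<and> Q \<le> Q_cr N \<alpha> \<sigma>"
  have critical: "\<exists>C>0. \<forall>f \<in> Cc_infty (inf_cyl :: ((real ^ 'n) \<times> real) set).
      weighted_sobolev_ineq C (Q_cr N \<alpha> \<sigma>) \<alpha> \<sigma> f"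
    using assms Q by (intro weighted_Sobolev_inequality_critical) auto
  show "\<exists>C>0. \<forall>f \<in> Cc_infty (inf_cyl :: ((real ^ 'n) \<times> real) set). weighted_sobolev_ineq C Q \<alpha> \<sigma> f"
  proof (cases "Q = Q_cr N \<alpha> \<sigma>")
    case False
    then show ?thesis
      using assms Q by (intro weighted_sobolev_ineq_lower_exponent[OF _ _ _ critical]) auto
  qed (use critical in simp)
next
  show "\<exists>C>0. \<forall>f \<in> Cc_infty (inf_cyl :: ((real ^ 'n) \<times> real) set). weighted_sobolev_ineq C 2 \<alpha> 2 f"
    using assms by (intro weighted_Poincare_inequality) auto
next
  fix Q :: real
  assume "2 < Q"
  then show "\<not> (\<exists>C. \<forall>f \<in> Cc_infty (fin_cyl :: ((real ^ 'n) \<times> real) set). weighted_sobolev_ineq C Q \<alpha> 2 f)"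
    using weighted_sobolev_ineq_sigma_2_fails[OF assms(3)] by blast
qed

end
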